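(* Let $N=2^n$, let $B:\mathbb{F}_2^n\to\mathbb{F}_2^n$ be a permutation given by a quantum oracle, let $w\in\mathbb{F}_2^n$ be non-zero, let $\mathrm{adv}=\mathrm{adv}(w,N\tau)$ be the probability that one draw of MACSample satisfies $\mathrm{Cor}(B,w;\alpha,\beta)^2\ge\tau$, and let $\tau=\omega(\log N/N)$. Then the algorithm MACFishingDistinguisher (described in the context) uses $O(1)$ quantum queries in Phase 1 and $O(1/\sqrt\tau)$ quantum queries in Phase 2, succeeding per run with probability $\mathrm{adv}$. Amplifying by $O(1/\mathrm{adv})$ repetitions gives total query complexity $$O\!\left(\frac{1}{\sqrt\tau\,\mathrm{adv}}\right)\ \text{(quantum verification)},\qquad O\!\left(\frac{1}{\tau\,\mathrm{adv}}\right)\ \text{(classical verification)}.$$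
   Context: For a permutation $B:\mathbb{F}_2^n\to\mathbb{F}_2^n$ put $C_w(\alpha,\beta)=\frac{1}{\sqrt N}\sum_{x}(-1)^{\alpha\cdot B(x)\oplus\beta\cdot B(x\oplus w)}$ and $\mathrm{Cor}(B,w;\alpha,\beta)=C_w(\alpha,\beta)/\sqrt N\in[-1,1]$, where $N=2^n$. Let $V_w^{\tau'}=\{(\alpha,\beta): C_w(\alpha,\beta)^2\ge\tau'\}$ and $\mathrm{adv}(w,\tau')=\frac1{N^2}\sum_{(\alpha,\beta)\in V_w^{\tau'}}C_w(\alpha,\beta)^2$; thus $\mathrm{Cor}^2\ge\tau$ iff $(\alpha,\beta)\in V_w^{N\tau}$. MACSample is a quantum sampler using $O(1)$ queries: on registers $|w\rangle|0^n\rangle|0^n\rangle$ apply $H^{\otimes n}$ to register 2, CNOT register 2 into register 3, CNOT register 1 into register 3, the oracle $|x\rangle\mapsto|B(x)\rangle$ on each of registers 2 and 3, $H^{\otimes n}$ on registers 2 and 3, and measure them to obtain $(\alpha,\beta)$ (repeating if $\alpha$ or $\beta$ is $0^n$). MACFishingDistinguisher: Phase 1 runs MACSample once to get $(\alpha,\beta)$. Phase 2 computes an estimate $\widehat{\mathrm{Cor}}$ of $\mathrm{Cor}(B,w;\alpha,\beta)$ to additive error $\varepsilon=\sqrt\tau$, and the algorithm outputs "cipher" if $\widehat{\mathrm{Cor}}^2\ge\tau$, otherwise "random permutation". Quantum verification: prepare $|\psi\rangle=2^{-n/2}\sum_x(-1)^{\alpha\cdot B(x)\oplus\beta\cdot B(x\oplus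 w)}|x\rangle$ with $O(1)$ queries, for which $\langle +^n|\psi\rangle=\mathrm{Cor}(B,w;\alpha,\beta)$, and estimate this signed overlap to error $\varepsilon$ by a Hadamard test with amplitude estimation. Classical verification: estimate $\mathrm{Cor}$ by averaging $(-1)^{\alpha\cdot B(x)\oplus\beta\cdot B(x\oplus w)}$ over uniformly random samples $x$. A run succeeds when the draw of Phase 1 is a pair with $\mathrm{Cor}^2\ge\tau$, which Phase 2 is to certify; amplification is to constant success probability.
   Formalization: When MACSample repeats on zero components, a draw satisfies Cor²≥τ with probability (adv(w,Nτ)−1/N)/(1−1/N), not adv(w,Nτ); this true draw probability is used as adv there, with expected O(1) Phase 1 queries. Without repetition adv=adv(w,Nτ) is kept. Phase 2 bounds are for τ≤1. *)

theory Defs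
  imports "HOL-Probability.Probability" "HOL-Library.Landau_Symbols"
begin

text \<open>A vector of $\mathbb{F}_2^n$ is encoded as a natural number below \<open>2 ^ n\<close>, its coordinates
  being the binary digits; addition is then bitwise \<^const>\<open>xor\<close>.\<close>

definition dot :: "nat \<Rightarrow> nat \<Rightarrow> nat \<Rightarrow> nat" where
  "dot n a b = (\<Sum>i<n. of_bool (bit a i \<and> bit b i)) mod 2"

definition mac_phase :: "nat \<Rightarrow> (nat \<Rightarrow> nat) \<Rightarrow> nat \<Rightarrow> nat \<Rightarrow> nat \<Rightarrow> nat \<Rightarrow> real" where
  "mac_phase n B w \<alpha> \<beta> x = (-1) ^ (dot n \<alpha> (B x) + dot n \<beta> (B (xor x w)))"

definition Cw :: "nat \<Rightarrow> (nat \<Rightarrow> nat) \<Rightarrow> nat \<Rightarrow> nat \<Rightarrow> nat \<Rightarrow> real" where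
  "Cw n B w \<alpha> \<beta> = 1 / sqrt (2 ^ n) * (\<Sum>x<2 ^ n. mac_phase n B w \<alpha> \<beta> x)"

definition Cor :: "nat \<Rightarrow> (nat \<Rightarrow> nat) \<Rightarrow> nat \<Rightarrow> nat \<times> nat \<Rightarrow> real" where
  "Cor n B w = (\<lambda>(\<alpha>, \<beta>). Cw n B w \<alpha> \<beta> / sqrt (2 ^ n))"

definition Vw :: "nat \<Rightarrow> (nat \<Rightarrow> nat) \<Rightarrow> nat \<Rightarrow> real \<Rightarrow> (nat \<times> nat) set" where
  "Vw n B w \<tau>' = {(\<alpha>, \<beta>). \<alpha> < 2 ^ n \<and> \<beta> < 2 ^ n \<and> (Cw n B w \<alpha> \<beta>)\<^sup>2 \<ge> \<tau>'}"

definition adv :: "nat \<Rightarrow> (nat \<Rightarrow> nat) \<Rightarrow> nat \<Rightarrow> real \<Rightarrow> real" where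
  "adv n B w \<tau>' = 1 / (2 ^ n)\<^sup>2 * (\<Sum>(\<alpha>, \<beta>)\<in>Vw n B w \<tau>'. (Cw n B w \<alpha> \<beta>)\<^sup>2)"

text \<open>The computational basis states of a list of registers of dimensions \<open>ds\<close> are the lists of
  register contents; a state assigns an amplitude to each of them. Registers are counted from 0.
  The oracle is the in-place map \<open>|x\<rangle> \<mapsto> |B(x)\<rangle>\<close>, and its adjoint may be queried as well. The other
  gates cannot depend on \<open>B\<close> and are free.\<close>

type_synonym state = "nat list \<Rightarrow> complex"

datatype gate =
    Local nat "nat \<Rightarrow> nat \<Rightarrow> complex" \<comment> \<open>the matrix with these entries, on one register\<close>
  | CNOT nat nat \<comment> \<open>adds the first register bitwise into the second\<close>
  | Diag "nat list \<Rightarrow> complex"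
  | Oracle nat
  | OracleAdj nat

type_synonym circuit = "gate list" \<comment> \<open>the head of the list acts first\<close>

definition basis :: "nat list \<Rightarrow> nat list set" where
  "basis ds = {s. length s = length ds \<and> (\<forall>i<length ds. s ! i < ds ! i)}"

text \<open>A permutation \<open>f\<close> of the basis, as a unitary, turns \<open>\<psi>\<close> into \<open>\<lambda>s. \<psi> (f\<inverse> s)\<close>: hence the inverse
  of \<open>B\<close> in the clause for \<^term>\<open>Oracle i\<close>.\<close>

primrec apply_gate :: "nat list \<Rightarrow> nat \<Rightarrow> (nat \<Rightarrow> nat) \<Rightarrow> gate \<Rightarrow> state \<Rightarrow> state" where
  "apply_gate ds n B (Local i G) \<psi> = (\<lambda>s. \<Sum>v<ds ! i. G (s ! i) v * \<psi> (s[i := v]))"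
| "apply_gate ds n B (CNOT i j) \<psi> = (\<lambda>s. \<psi> (s[j := xor (s ! j) (s ! i)]))"
| "apply_gate ds n B (Diag d) \<psi> = (\<lambda>s. d s * \<psi> s)"
| "apply_gate ds n B (Oracle i) \<psi> = (\<lambda>s. \<psi> (s[i := inv_into {..<2 ^ n} B (s ! i)]))"
| "apply_gate ds n B (OracleAdj i) \<psi> = (\<lambda>s. \<psi> (s[i := B (s ! i)]))"

primrec adj_gate :: "gate \<Rightarrow> gate" where
  "adj_gate (Local i G) = Local i (\<lambda>u v. cnj (G v u))"
| "adj_gate (CNOT i j) = CNOT i j"
| "adj_gate (Diag d) = Diag (\<lambda>s. cnj (d s))"
| "adj_gate (Oracle i) = OracleAdj i"
| "adj_gate (OracleAdj i) = Oracle i"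

definition adj :: "circuit \<Rightarrow> circuit" where
  "adj c = rev (map adj_gate c)"

primrec gate_queries :: "gate \<Rightarrow> nat" where
  "gate_queries (Local i G) = 0"
| "gate_queries (CNOT i j) = 0"
| "gate_queries (Diag d) = 0"
| "gate_queries (Oracle i) = 1"
| "gate_queries (OracleAdj i) = 1"

definition circuit_queries :: "circuit \<Rightarrow> nat" where
  "circuit_queries c = sum_list (map gate_queries c)"

definition run_circuit ::
    "nat list \<Rightarrow> nat \<Rightarrow> (nat \<Rightarrow> nat) \<Rightarrow> circuit \<Rightarrow> nat list \<Rightarrow> state" where
  "run_circuit ds n B c s0 = fold (apply_gate ds n B) c (\<lambda>s. if s = s0 then 1 else 0)"

text \<open>Meaningful only for states normalised on the basis, as those produced by unitary circuits are.\<close>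

definition measured :: "nat list \<Rightarrow> state \<Rightarrow> nat list pmf" where
  "measured ds \<psi> = embed_pmf (\<lambda>s. if s \<in> basis ds then (cmod (\<psi> s))\<^sup>2 else 0)"

definition hadamard :: "nat \<Rightarrow> nat \<Rightarrow> nat \<Rightarrow> complex" where
  "hadamard n u v = (-1) ^ dot n u v / complex_of_real (sqrt (2 ^ n))"

definition fourier :: "nat \<Rightarrow> nat \<Rightarrow> nat \<Rightarrow> complex" where
  "fourier M u v = cis (2 * pi * real u * real v / real M) / complex_of_real (sqrt (real M))"

definition mac_circuit :: "nat \<Rightarrow> circuit" where
  "mac_circuit n =
     [Local 1 (hadamard n), CNOT 1 2, CNOT 0 2, Oracle 1, Oracle 2,
      Local 1 (hadamard n), Local 2 (hadamard n)]"

definition mac_measure :: "nat \<Rightarrow> (nat \<Rightarrow> nat) \<Rightarrow> nat \<Rightarrow> (nat \<times> nat) pmf" where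
  "mac_measure n B w = map_pmf (\<lambda>s. (s ! 1, s ! 2))
     (let ds = [2 ^ n, 2 ^ n, 2 ^ n] in measured ds (run_circuit ds n B (mac_circuit n) [w, 0, 0]))"

text \<open>The circuit is repeated as long as the outcome lies in \<open>rej\<close>. The result is the accepted pair
  together with the number of queries made. Repetition on a zero component is
  \<open>rej = zero_pairs\<close>; a draw without any repetition is \<open>rej = {}\<close>.
  The two differ in law: the pair \<open>(0, 0)\<close>, of correlation 1, is measured with probability \<open>1 / 2 ^ n\<close>
  and counts in \<^const>\<open>adv\<close>.\<close>

partial_function (spmf) macsample ::
    "(nat \<times> nat) set \<Rightarrow> nat \<Rightarrow> (nat \<Rightarrow> nat) \<Rightarrow> nat \<Rightarrow> ((nat \<times> nat) \<times> nat) spmf" where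
  "macsample rej n B w =
     bind_spmf (spmf_of_pmf (mac_measure n B w)) (\<lambda>p.
       if p \<in> rej
       then map_spmf (\<lambda>(p', q). (p', circuit_queries (mac_circuit n) + q)) (macsample rej n B w)
       else return_spmf (p, circuit_queries (mac_circuit n)))"

definition zero_pairs :: "(nat \<times> nat) set" where
  "zero_pairs = {(\<alpha>, \<beta>). \<alpha> = 0 \<or> \<beta> = 0}"

definition draw_prob ::
    "(nat \<times> nat) set \<Rightarrow> nat \<Rightarrow> (nat \<Rightarrow> nat) \<Rightarrow> nat \<Rightarrow> real \<Rightarrow> real" where
  "draw_prob rej n B w \<tau> =
     measure (measure_spmf (macsample rej n B w)) {(p, q). (Cor n B w p)\<^sup>2 \<ge> \<tau>}"

text \<open>Registers: 0 holds \<open>w\<close>, 1 and 2 are \<open>n\<close>-bit registers, 3 is the qubit of the Hadamard test,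
  4 is the counter of amplitude estimation, of dimension \<open>M\<close>.\<close>

text \<open>On \<open>|x\<rangle>\<close> in register 1, this multiplies by
  $(-1)^{\alpha\cdot B(x)\oplus\beta\cdot B(x\oplus w)}$ when the qubit is 1, so that the uniform
  superposition becomes $|\psi\rangle$, and leaves register 2 at 0. Only the phase is controlled.\<close>

definition controlled_phase :: "nat \<Rightarrow> nat \<Rightarrow> nat \<Rightarrow> circuit" where
  "controlled_phase n \<alpha> \<beta> =
     [CNOT 1 2, CNOT 0 2, Oracle 1, Oracle 2,
      Diag (\<lambda>s. if s ! 3 = 1 then (-1) ^ (dot n \<alpha> (s ! 1) + dot n \<beta> (s ! 2)) else 1),
      OracleAdj 2, OracleAdj 1, CNOT 0 2, CNOT 1 2]"

text \<open>The Hadamard test: the qubit reads 0 with probability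
  $(1 + \langle +^n|\psi\rangle) / 2 = (1 + \mathrm{Cor}) / 2$.\<close>

definition hadamard_test :: "nat \<Rightarrow> nat \<Rightarrow> nat \<Rightarrow> circuit" where
  "hadamard_test n \<alpha> \<beta> =
     [Local 3 (hadamard 1), Local 1 (hadamard n)] @ controlled_phase n \<alpha> \<beta> @ [Local 3 (hadamard 1)]"

text \<open>With \<open>A\<close> the Hadamard test, the amplitude amplification operator
  $-A S_0 A^{-1} S_\chi$, applied if the counter exceeds \<open>k\<close>. It suffices to control the two
  reflections, since \<open>A\<close> and its adjoint cancel otherwise.\<close>

definition grover :: "nat \<Rightarrow> nat \<Rightarrow> nat \<Rightarrow> nat \<Rightarrow> circuit" where
  "grover n \<alpha> \<beta> k =
     [Diag (\<lambda>s. if k < s ! 4 \<and> s ! 3 = 0 then -1 else 1)] @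
     adj (hadamard_test n \<alpha> \<beta>) @
     [Diag (\<lambda>s. if k < s ! 4 \<and> \<not> (s ! 1 = 0 \<and> s ! 2 = 0 \<and> s ! 3 = 0) then -1 else 1)] @
     hadamard_test n \<alpha> \<beta>"

definition amplitude_estimation :: "nat \<Rightarrow> nat \<Rightarrow> nat \<Rightarrow> nat \<Rightarrow> circuit" where
  "amplitude_estimation n \<alpha> \<beta> M =
     hadamard_test n \<alpha> \<beta> @ [Local 4 (fourier M)] @
     concat (map (grover n \<alpha> \<beta>) [0..<M - 1]) @ adj [Local 4 (fourier M)]"

text \<open>A counter outcome \<open>y\<close> gives the estimate $\sin^2(\pi y/M)$ of $(1 + \mathrm{Cor})/2$, with error
  $O(1/M)$. An estimate comes with the number of queries it took.\<close>

definition quantum_estimate ::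
    "nat \<Rightarrow> (nat \<Rightarrow> nat) \<Rightarrow> nat \<Rightarrow> nat \<times> nat \<Rightarrow> real \<Rightarrow> (real \<times> nat) pmf" where
  "quantum_estimate n B w = (\<lambda>(\<alpha>, \<beta>) \<epsilon>.
     let M = nat \<lceil>32 / \<epsilon>\<rceil>;
         c = amplitude_estimation n \<alpha> \<beta> M;
         ds = [2 ^ n, 2 ^ n, 2 ^ n, 2, M]
     in map_pmf (\<lambda>s. (2 * (sin (pi * real (s ! 4) / real M))\<^sup>2 - 1, circuit_queries c))
          (measured ds (run_circuit ds n B c [w, 0, 0, 0, 0])))"

text \<open>A classical sample queries \<open>B\<close> at \<open>x\<close> and at \<open>xor x w\<close>.\<close>

definition classical_sample ::
    "nat \<Rightarrow> (nat \<Rightarrow> nat) \<Rightarrow> nat \<Rightarrow> nat \<times> nat \<Rightarrow> (real \<times> nat) pmf" where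
  "classical_sample n B w = (\<lambda>(\<alpha>, \<beta>).
     map_pmf (\<lambda>x. (mac_phase n B w \<alpha> \<beta> x, 2)) (pmf_of_set {..<2 ^ n}))"

definition classical_estimate ::
    "nat \<Rightarrow> (nat \<Rightarrow> nat) \<Rightarrow> nat \<Rightarrow> nat \<times> nat \<Rightarrow> real \<Rightarrow> (real \<times> nat) pmf" where
  "classical_estimate n B w p \<epsilon> =
     (let m = nat \<lceil>3 / \<epsilon>\<^sup>2\<rceil>
      in map_pmf (\<lambda>xs. (sum_list (map fst xs) / real m, sum_list (map snd xs)))
           (replicate_pmf m (classical_sample n B w p)))"

datatype verdict = Cipher | RandomPermutation

datatype run = Run (draw: "nat \<times> nat") (estimate: real) (verdict: verdict)
  (queries1: nat) (queries2: nat)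

type_synonym verifier =
  "nat \<Rightarrow> (nat \<Rightarrow> nat) \<Rightarrow> nat \<Rightarrow> nat \<times> nat \<Rightarrow> real \<Rightarrow> (real \<times> nat) pmf"

definition fishing ::
    "(nat \<times> nat) set \<Rightarrow> verifier \<Rightarrow> nat \<Rightarrow> (nat \<Rightarrow> nat) \<Rightarrow> nat \<Rightarrow> real \<Rightarrow> run spmf" where
  "fishing rej verify n B w \<tau> =
     bind_spmf (macsample rej n B w) (\<lambda>(p, q1).
     bind_spmf (spmf_of_pmf (verify n B w p (sqrt \<tau>))) (\<lambda>(e, q2).
     return_spmf (Run p e (if e\<^sup>2 \<ge> \<tau> then Cipher else RandomPermutation) q1 q2)))"

text \<open>A run succeeds when its draw is a pair of squared correlation at least \<open>\<tau>\<close>.\<close>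

definition success :: "nat \<Rightarrow> (nat \<Rightarrow> nat) \<Rightarrow> nat \<Rightarrow> real \<Rightarrow> run \<Rightarrow> bool" where
  "success n B w \<tau> r \<longleftrightarrow> (Cor n B w (draw r))\<^sup>2 \<ge> \<tau>"

definition accurate :: "nat \<Rightarrow> (nat \<Rightarrow> nat) \<Rightarrow> nat \<Rightarrow> real \<Rightarrow> run \<Rightarrow> bool" where
  "accurate n B w \<tau> r \<longleftrightarrow> \<bar>estimate r - Cor n B w (draw r)\<bar> \<le> sqrt \<tau>"

primrec repeat_spmf :: "nat \<Rightarrow> 'a spmf \<Rightarrow> 'a list spmf" where
  "repeat_spmf 0 p = return_spmf []"
| "repeat_spmf (Suc k) p =
     bind_spmf p (\<lambda>x. bind_spmf (repeat_spmf k p) (\<lambda>xs. return_spmf (x # xs)))"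

definition total_queries :: "run list \<Rightarrow> nat" where
  "total_queries rs = (\<Sum>r\<leftarrow>rs. queries1 r + queries2 r)"

end

theory Submission
  imports Defs
begin

text \<open>
  Running the circuit of MACSample on a basis state gives the outcome $(\alpha,\beta)$ the amplitude
  $C_w(\alpha,\beta)/N$, so a pair is drawn with probability $C_w(\alpha,\beta)^2/N^2$. The only
  outcome with a zero component that occurs is $(0,0)$, with probability $1/N \le 1/2$; rejecting it
  costs a constant factor in expectation.

  On the plane spanned by the two parts of the state prepared by the Hadamard test, in which the
  qubit is 0 or 1, a Grover step is the rotation by $2\theta$ with
  $\sin^2\theta = (1+\mathrm{Cor})/2$. By the parallelogram law, the probability of
  the counter value $y$ is therefore at most the average of two Fejer kernels, at $\pm\theta-\pi y/M$. Since
  $\sin^2 a-\sin^2 b=\sin(a+b)\sin(a-b)$, a bad estimate keeps both arguments away from the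
  multiples of $\pi$, where the kernels have a small tail. Classical sampling is covered by Chebyshev's
  inequality.

  A run succeeds and is certified with probability at least $\frac23\,\mathrm{adv}$, hence
  $O(1/\mathrm{adv})$ independent runs suffice, and Markov's inequality bounds the total cost.
\<close>

section \<open>Hadamard and Fourier matrices\<close>

text \<open>No eigenvectors of the Grover operator are computed. After \<open>j\<close> steps the
  coordinates of the state in the plane are the sine and the cosine of
  \<open>(2 * j + 1) * angle\<close>, and the inverse Fourier transform acts on these two sequences.
  The law of the counter depends only on the sum of their squared moduli, call them S and C, and C +
  iS and C - iS are geometric sums. This also covers correlation 1 or -1, where the plane
  degenerates to a line: one of the two parts is then the zero vector, so its norm is only bounded
  by 1, and this is enough for an upper bound on the tail. The recursion of the sampler enters only
  through its fixed point equation. For probabilities this is a solvable linear equation as soon as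
  rejection is not certain; for the expected cost it would also admit the value infinity, which has
  to be excluded separately. Accuracy of the estimate is proved for every pair, not on average. It
  therefore holds conditionally on each draw, and the factor 2/3 simply multiplies the probability
  of a good draw.\<close>

lemma dot_commute: "dot n a b = dot n b a"
  unfolding dot_def by (simp add: conj_commute)

lemma dot_0_right [simp]: "dot n a 0 = 0"
  unfolding dot_def by simp

lemma dot_0_left [simp]: "dot n 0 a = 0"
  unfolding dot_def by simp

text \<open>Only the parity of the exponent matters, so the reduction modulo 2 in \<open>dot\<close>
  disappears and the sign becomes a product over coordinates, in which identities can be checked
  factor by factor.\<close>

lemma sign_dot:
  "(- 1 :: 'a::comm_ring_1) ^ dot n a b = (\<Prod>i<n. if bit a i \<and> bit b i then - 1 else 1)"
proof -
  have "(- 1 :: 'a) ^ (m mod 2) = (- 1) ^ m" for m :: nat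
    by (cases "even m") (auto simp: even_iff_mod_2_eq_zero odd_iff_mod_2_eq_one)
  moreover have "(- 1 :: 'a) ^ (\<Sum>i\<in>I. f i) = (\<Prod>i\<in>I. (- 1) ^ f i)" for f and I :: "nat set"
    by (rule power_sum)
  ultimately have "(- 1 :: 'a) ^ dot n a b = (\<Prod>i<n. (- 1) ^ of_bool (bit a i \<and> bit b i))"
    unfolding dot_def by (simp only:)
  also have "\<dots> = (\<Prod>i<n. if bit a i \<and> bit b i then - 1 else 1)"
    by (rule prod.cong) auto
  finally show ?thesis .
qed

lemma sign_dot_xor:
  "(- 1 :: 'a::comm_ring_1) ^ dot n (xor a a') b = (- 1) ^ dot n a b * (- 1) ^ dot n a' b"
  unfolding sign_dot prod.distrib[symmetric] by (rule prod.cong) (auto simp: bit_xor_iff)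

lemma xor_less_two_power:
  assumes "a < 2 ^ n" "b < 2 ^ n" shows "xor a b < (2 :: nat) ^ n"
proof -
  have "take_bit n (xor a b) = xor a b"
    using assms by (simp add: take_bit_xor take_bit_nat_eq_self)
  then show ?thesis by (metis take_bit_nat_less_exp)
qed

lemma xor_cancel_right [simp]: "xor (xor a b) b = (a :: nat)"
  by (simp add: xor.assoc)

lemma ex_bit_less:
  assumes "0 < b" "b < (2 :: nat) ^ n" shows "\<exists>i<n. bit b i"
proof -
  obtain i where i: "bit b i" using assms(1) bit_eq_iff[of b 0] by auto
  have "i < n"
    using i assms(2) bit_take_bit_iff[of n b i] by (simp add: take_bit_nat_eq_self)
  with i show ?thesis by blast
qed

text \<open>A sign-reversing involution: flipping in \<open>a\<close> a bit that is set in
  \<open>b\<close> negates every term, so for nonzero \<open>b\<close> the sum equals its own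
  negative.\<close>

lemma sum_sign_dot:
  assumes "b < 2 ^ n"
  shows "(\<Sum>a<2 ^ n. (- 1 :: 'a::{idom, ring_char_0}) ^ dot n a b) = (if b = 0 then 2 ^ n else 0)"
proof (cases "b = 0")
  case False
  then obtain i where i: "i < n" "bit b i" using ex_bit_less assms by blast
  let ?e = "2 ^ i :: nat"
  let ?s = "\<lambda>a. (- 1 :: 'a) ^ dot n a b"
  have e: "?e < 2 ^ n" using i by simp
  have flip: "?s ?e = - 1"
  proof -
    have "?s ?e = (\<Prod>j\<in>{..<n}. if j = i then - 1 else 1)"
      unfolding sign_dot using i by (intro prod.cong) (auto simp: bit_exp_iff)
    also have "\<dots> = - 1" using i by simp
    finally show ?thesis .
  qed
  have "(\<Sum>a<2 ^ n. ?s a) = (\<Sum>a<2 ^ n. ?s (xor a ?e))"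
    by (rule sum.reindex_bij_witness[of _ "\<lambda>a. xor a ?e" "\<lambda>a. xor a ?e"])
       (use e in \<open>auto intro: xor_less_two_power\<close>)
  also have "\<dots> = - (\<Sum>a<2 ^ n. ?s a)"
    by (simp only: sign_dot_xor flip mult_minus_right mult_1_right sum_negf)
  finally have "2 * (\<Sum>a<2 ^ n. ?s a) = 0" by (metis add.right_inverse mult_2)
  then have "(\<Sum>a<2 ^ n. ?s a) = 0" by (metis mult_eq_0_iff zero_neq_numeral)
  then show ?thesis using False by (simp only: if_False)
qed simp

lemma xor_eq_0_iff_nat: "xor a b = 0 \<longleftrightarrow> a = (b :: nat)"
  by (metis xor.assoc xor.left_neutral xor_self_eq)

lemma hadamard_commute: "hadamard n u v = hadamard n v u"
  by (simp add: hadamard_def dot_commute)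

lemma cnj_hadamard [simp]: "cnj (hadamard n u v) = hadamard n u v"
  by (simp add: hadamard_def)

lemma hadamard_orthogonal:
  assumes "u < 2 ^ n" "v < 2 ^ n"
  shows "(\<Sum>x<2 ^ n. hadamard n x u * hadamard n x v) = of_bool (u = v)"
proof -
  have sq: "complex_of_real (sqrt (2 ^ n)) * complex_of_real (sqrt (2 ^ n)) = 2 ^ n"
    by (metis of_real_mult of_real_numeral of_real_power real_sqrt_mult_self abs_numeral power_abs)
  have "(\<Sum>x<2 ^ n. hadamard n x u * hadamard n x v)
      = (\<Sum>x<2 ^ n. (- 1) ^ dot n x (xor u v)) / 2 ^ n"
    unfolding hadamard_def sum_divide_distrib
    by (intro sum.cong refl) (simp add: dot_commute[of n _ "xor u v"] sign_dot_xor sq dot_commute[of n u] dot_commute[of n v])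
  also have "\<dots> = of_bool (u = v)"
    using assms by (simp add: sum_sign_dot xor_less_two_power xor_eq_0_iff_nat)
  finally show ?thesis .
qed

text \<open>Orthonormality of the columns is asked only for indices below \<open>d\<close>; entries
  beyond the dimension of a register do not act on basis states.\<close>

definition unitary_matrix :: "nat \<Rightarrow> (nat \<Rightarrow> nat \<Rightarrow> complex) \<Rightarrow> bool" where
  "unitary_matrix d G \<longleftrightarrow> (\<forall>u<d. \<forall>v<d. (\<Sum>x<d. cnj (G x u) * G x v) = of_bool (u = v))"

lemma unitary_matrix_hadamard: "unitary_matrix (2 ^ n) (hadamard n)"
  by (simp add: unitary_matrix_def hadamard_orthogonal)

text \<open>Expanding the squares and summing over \<open>x\<close> first leaves the Gram matrix of
  the columns, which is the identity.\<close>

lemma parseval_unitary_matrix: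
  assumes "unitary_matrix d G"
  shows "(\<Sum>x<d. (cmod (\<Sum>v<d. G x v * f v))\<^sup>2) = (\<Sum>v<d. (cmod (f v))\<^sup>2)"
proof -
  have "complex_of_real (\<Sum>x<d. (cmod (\<Sum>v<d. G x v * f v))\<^sup>2)
      = (\<Sum>x<d. \<Sum>v<d. \<Sum>u<d. (G x v * f v) * cnj (G x u * f u))"
    by (simp add: complex_norm_square sum_product del: of_real_power)
  also have "\<dots> = (\<Sum>v<d. \<Sum>u<d. \<Sum>x<d. (G x v * f v) * cnj (G x u * f u))"
    by (subst sum.swap, rule sum.cong[OF refl], rule sum.swap)
  also have "\<dots> = (\<Sum>v<d. \<Sum>u<d. f v * cnj (f u) * (\<Sum>x<d. cnj (G x u) * G x v))"
    by (simp add: sum_distrib_left mult_ac)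
  also have "\<dots> = (\<Sum>v<d. \<Sum>u<d. if u = v then f v * cnj (f u) else 0)"
    using assms unfolding unitary_matrix_def by (intro sum.cong refl) auto
  also have "\<dots> = complex_of_real (\<Sum>v<d. (cmod (f v))\<^sup>2)"
    by (simp add: complex_norm_square del: of_real_power)
  finally show ?thesis by (rule of_real_eq_iff[THEN iffD1])
qed

text \<open>The inner product of two columns is a geometric series in an \<open>M\<close>-th root of
  unity. The second form serves the inverse transform that ends amplitude estimation; it is the
  conjugate of the first, the matrix being symmetric.\<close>

lemma fourier_orthogonal:
  assumes "u < M" "v < M"
  shows "(\<Sum>x<M. cnj (fourier M x u) * fourier M x v) = of_bool (u = v)"
    "(\<Sum>x<M. cnj (cnj (fourier M u x)) * cnj (fourier M v x)) = of_bool (u = v)"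
proof -
  have M: "M > 0" using assms by simp
  define z where "z = cis (2 * pi * (real v - real u) / real M)"
  have sq: "complex_of_real (sqrt (real M)) * complex_of_real (sqrt (real M)) = of_nat M"
    by (metis of_real_mult of_real_of_nat_eq real_sqrt_mult_self abs_of_nat)
  have e: "cnj (fourier M x u) * fourier M x v = z ^ x / of_nat M" for x
    using M by (simp add: fourier_def z_def cis_cnj cis_mult Complex.DeMoivre sq diff_divide_distrib algebra_simps)
  have e1: "(\<Sum>x<M. cnj (fourier M x u) * fourier M x v) = (\<Sum>x<M. z ^ x) / of_nat M"
    unfolding e sum_divide_distrib ..
  show *: "(\<Sum>x<M. cnj (fourier M x u) * fourier M x v) = of_bool (u = v)"
  proof (cases "u = v")
    case True then show ?thesis unfolding e1 using M by (simp add: z_def)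
  next
    case False
    have "z ^ M = 1"
    proof -
      have "z ^ M = cis (2 * pi * of_int (int v - int u))"
        using M by (simp add: z_def Complex.DeMoivre mult.commute)
      then show ?thesis by (simp add: cis_multiple_2pi)
    qed
    \<comment> \<open>Otherwise \<open>M\<close> would divide the nonzero integer
      \<open>v - u\<close>, whose absolute value is below \<open>M\<close>.\<close>
    moreover have "z \<noteq> 1"
    proof
      assume "z = 1"
      then have "cos (2 * pi * (real v - real u) / real M) = 1"
        by (metis z_def cis.simps(1) one_complex.simps(1))
      then obtain k :: int where "2 * pi * (real v - real u) / real M = of_int k * 2 * pi"
        by (auto simp: cos_one_2pi_int)
      then have "(real v - real u) / real M = of_int k"
        by (metis (no_types, opaque_lifting) mult.commute mult_cancel_left pi_neq_zero times_divide_eq_right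
            mult.left_commute zero_neq_numeral)
      then have "of_int (int v - int u) = real_of_int (k * int M)" using M by (simp add: field_simps)
      then have k: "int v - int u = k * int M" by linarith
      then have "int M dvd (int v - int u)" by simp
      then have "int M \<le> \<bar>int v - int u\<bar>" using False zdvd_imp_le by fastforce
      then show False using assms by linarith
    qed
    ultimately have "(\<Sum>x<M. z ^ x) = 0" by (simp add: geometric_sum)
    then show ?thesis unfolding e1 using False by simp
  qed
  have "fourier M a b = fourier M b a" for a b by (simp add: fourier_def mult_ac)
  then show "(\<Sum>x<M. cnj (cnj (fourier M u x)) * cnj (fourier M v x)) = of_bool (u = v)"
    using arg_cong[OF *, of cnj] by (simp add: mult.commute)
qed

lemma unitary_matrix_fourier:
  "unitary_matrix M (fourier M)" "unitary_matrix M (\<lambda>u v. cnj (fourier M v u))"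
  by (simp_all add: unitary_matrix_def fourier_orthogonal del: complex_cnj_cnj)

section \<open>Circuits preserve the norm\<close>

lemma finite_basis: "finite (basis ds)"
proof (rule finite_subset)
  show "basis ds \<subseteq> {s. set s \<subseteq> {..<sum_list ds} \<and> length s = length ds}"
  proof safe
    fix s x assume s: "s \<in> basis ds" and "x \<in> set s"
    then obtain i where i: "i < length ds" "x = s ! i" by (auto simp: in_set_conv_nth basis_def)
    then have "x < ds ! i" using s by (simp add: basis_def)
    also have "ds ! i \<le> sum_list ds" using i by (simp add: member_le_sum_list)
    finally show "x < sum_list ds" .
  qed (simp add: basis_def)
  show "finite {s. set s \<subseteq> {..<sum_list ds} \<and> length s = length ds}"
    by (rule finite_lists_length_eq) simp
qed

lemma basis_update: "s \<in> basis ds \<Longrightarrow> v < ds ! i \<Longrightarrow> s[i := v] \<in> basis ds"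
  by (cases "i < length s") (auto simp: basis_def nth_list_update)

text \<open>Basis states that differ only in register \<open>i\<close> form a fibre, represented by
  its member with 0 in that register. One-register gates act within fibres.\<close>

lemma sum_basis_split:
  assumes "i < length ds"
  shows "(\<Sum>s\<in>basis ds. f s) = (\<Sum>t\<in>{t \<in> basis ds. t ! i = 0}. \<Sum>v<ds ! i. f (t[i := v]))"
  unfolding sum.cartesian_product
  by (rule sum.reindex_bij_witness[of _ "\<lambda>(t, v). t[i := v]" "\<lambda>s. (s[i := 0], s ! i)"])
     (use assms in \<open>auto intro!: basis_update simp: basis_def nth_list_update list_update_same_conv intro: le_less_trans\<close>)

text \<open>The permutation of register \<open>i\<close> may depend on the other registers, which it
  receives as \<open>s[i := 0]\<close>. This covers CNOT, where the shift is read from another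
  register, together with both oracle gates.\<close>

lemma sum_basis_update:
  assumes "i < length ds" "\<And>s. s \<in> basis ds \<Longrightarrow> bij_betw (h (s[i := 0])) {..<ds ! i} {..<ds ! i}"
  shows "(\<Sum>s\<in>basis ds. f (s[i := h (s[i := 0]) (s ! i)])) = (\<Sum>s\<in>basis ds. f s :: 'b::comm_monoid_add)"
  unfolding sum_basis_split[OF assms(1)]
proof (rule sum.cong[OF refl])
  fix t assume t: "t \<in> {t \<in> basis ds. t ! i = 0}"
  then have t0: "t[i := 0] = t" by (metis (mono_tags) list_update_id mem_Collect_eq)
  have l: "length t = length ds" using t by (simp add: basis_def)
  have "bij_betw (h t) {..<ds ! i} {..<ds ! i}" using assms(2)[of t] t t0 by simp
  then have "(\<Sum>v<ds ! i. f (t[i := h t v])) = (\<Sum>v<ds ! i. f (t[i := v]))"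
    by (rule sum.reindex_bij_betw)
  then show "(\<Sum>v<ds ! i. f (t[i := v, i := h (t[i := v, i := 0]) (t[i := v] ! i)])) = (\<Sum>v<ds ! i. f (t[i := v]))"
    using assms(1) l by (simp add: t0)
qed

text \<open>Conditions making a gate unitary on the basis when \<open>B\<close> is a permutation;
  \<open>apply_gate\<close> by itself accepts arbitrary matrices, diagonals and register
  numbers.\<close>

primrec valid_gate :: "nat list \<Rightarrow> nat \<Rightarrow> gate \<Rightarrow> bool" where
  "valid_gate ds n (Local i G) \<longleftrightarrow> i < length ds \<and> unitary_matrix (ds ! i) G"
| "valid_gate ds n (CNOT i j) \<longleftrightarrow>
     i < length ds \<and> j < length ds \<and> i \<noteq> j \<and> ds ! i = 2 ^ n \<and> ds ! j = 2 ^ n"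
| "valid_gate ds n (Diag d) \<longleftrightarrow> (\<forall>s. cmod (d s) = 1)"
| "valid_gate ds n (Oracle i) \<longleftrightarrow> i < length ds \<and> ds ! i = 2 ^ n"
| "valid_gate ds n (OracleAdj i) \<longleftrightarrow> i < length ds \<and> ds ! i = 2 ^ n"

lemma norm_apply_gate:
  assumes B: "bij_betw B {..<2 ^ n} {..<2 ^ n}" and g: "valid_gate ds n g"
  shows "(\<Sum>s\<in>basis ds. (cmod (apply_gate ds n B g \<psi> s))\<^sup>2) = (\<Sum>s\<in>basis ds. (cmod (\<psi> s))\<^sup>2)"
proof (cases g)
  case (Local i G)
  then have i: "i < length ds" and G: "unitary_matrix (ds ! i) G" using g by auto
  show ?thesis
    unfolding sum_basis_split[OF i]
  proof (rule sum.cong[OF refl])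
    fix t assume "t \<in> {t \<in> basis ds. t ! i = 0}"
    then have "length t = length ds" by (simp add: basis_def)
    then show "(\<Sum>v<ds ! i. (cmod (apply_gate ds n B g \<psi> (t[i := v])))\<^sup>2) = (\<Sum>v<ds ! i. (cmod (\<psi> (t[i := v])))\<^sup>2)"
      using i Local parseval_unitary_matrix[OF G, of "\<lambda>v. \<psi> (t[i := v])"] by simp
  qed
next
  case (CNOT i j)
  then have ij: "i < length ds" "j < length ds" "i \<noteq> j" "ds ! i = 2 ^ n" "ds ! j = 2 ^ n" using g by auto
  have "(\<Sum>s\<in>basis ds. (cmod (\<psi> (s[j := (\<lambda>t v. xor v (t ! i)) (s[j := 0]) (s ! j)])))\<^sup>2)
      = (\<Sum>s\<in>basis ds. (cmod (\<psi> s))\<^sup>2)"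
  proof (rule sum_basis_update)
    fix s assume s: "s \<in> basis ds"
    then have "s[j := 0] ! i < 2 ^ n" using ij by (auto simp: basis_def)
    then show "bij_betw (\<lambda>v. xor v (s[j := 0] ! i)) {..<ds ! j} {..<ds ! j}"
      using ij by (intro bij_betw_byWitness[of _ "\<lambda>v. xor v (s[j := 0] ! i)"]) (auto intro: xor_less_two_power)
  qed (use ij in auto)
  then show ?thesis using CNOT ij by simp
next
  case (Diag d)
  then show ?thesis using g by (simp add: norm_mult)
next
  case (Oracle i)
  then have i: "i < length ds" "ds ! i = 2 ^ n" using g by auto
  then show ?thesis
    using Oracle sum_basis_update[of i ds "\<lambda>_. inv_into {..<2 ^ n} B" "\<lambda>s. (cmod (\<psi> s))\<^sup>2"] bij_betw_inv_into[OF B]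
    by simp
next
  case (OracleAdj i)
  then have i: "i < length ds" "ds ! i = 2 ^ n" using g by auto
  then show ?thesis
    using OracleAdj sum_basis_update[of i ds "\<lambda>_. B" "\<lambda>s. (cmod (\<psi> s))\<^sup>2"] B
    by simp
qed

text \<open>This is the normalisation that \<open>measured\<close> presupposes: without it the
  squared amplitudes need not form a probability distribution.\<close>

lemma norm_run_circuit:
  assumes B: "bij_betw B {..<2 ^ n} {..<2 ^ n}" and c: "list_all (valid_gate ds n) c"
    and s0: "s0 \<in> basis ds"
  shows "(\<Sum>s\<in>basis ds. (cmod (run_circuit ds n B c s0 s))\<^sup>2) = 1"
proof -
  have "(\<Sum>s\<in>basis ds. (cmod (fold (apply_gate ds n B) c \<psi> s))\<^sup>2) = (\<Sum>s\<in>basis ds. (cmod (\<psi> s))\<^sup>2)" for \<psi>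
    using c by (induction c arbitrary: \<psi>) (simp_all add: norm_apply_gate[OF B])
  moreover have "(\<Sum>s\<in>basis ds. (cmod (if s = s0 then 1 else 0))\<^sup>2) = (\<Sum>s\<in>basis ds. if s = s0 then 1 else 0)"
    by (rule sum.cong) auto
  ultimately show ?thesis using s0 by (simp add: run_circuit_def finite_basis)
qed

lemma pmf_measured:
  assumes "(\<Sum>s\<in>basis ds. (cmod (\<psi> s))\<^sup>2) = 1"
  shows "pmf (measured ds \<psi>) s = (if s \<in> basis ds then (cmod (\<psi> s))\<^sup>2 else 0)"
  unfolding measured_def
proof (rule pmf_embed_pmf)
  have "(\<integral>\<^sup>+ s. ennreal (if s \<in> basis ds then (cmod (\<psi> s))\<^sup>2 else 0) \<partial>count_space UNIV)
      = (\<Sum>s\<in>basis ds. ennreal ((cmod (\<psi> s))\<^sup>2))"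
    by (subst nn_integral_count_space'[of "basis ds"]) (auto simp: finite_basis)
  also have "\<dots> = 1" using assms by (simp add: sum_ennreal)
  finally show "(\<integral>\<^sup>+ s. ennreal (if s \<in> basis ds then (cmod (\<psi> s))\<^sup>2 else 0) \<partial>count_space UNIV) = 1" .
qed auto

section \<open>The distribution of MACSample\<close>

lemma bij_betw_xor:
  assumes "w < 2 ^ n"
  shows "bij_betw (\<lambda>x. xor x w) {..<2 ^ n} {..<(2 :: nat) ^ n}"
  by (rule bij_betw_byWitness[of _ "\<lambda>x. xor x w"]) (use assms in \<open>auto intro: xor_less_two_power\<close>)

text \<open>Unfolding runs backwards from the outcome, so the summation indices are oracle outputs.
  Substituting \<open>u = B x\<close> and \<open>v = B y\<close> cancels the inverse of
  \<open>B\<close>; the two CNOT gates and the initial state then force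
  \<open>x = xor y w\<close>.\<close>

lemma mac_amplitude:
  assumes B: "bij_betw B {..<2 ^ n} {..<2 ^ n}" and w: "w < 2 ^ n"
  shows "run_circuit [2 ^ n, 2 ^ n, 2 ^ n] n B (mac_circuit n) [w, 0, 0] [a, \<alpha>, \<beta>]
    = (if a = w then complex_of_real (Cw n B w \<alpha> \<beta> / 2 ^ n) else 0)"
proof -
  let ?N = "2 ^ n :: nat"
  let ?I = "inv_into {..<?N} B"
  let ?H = "hadamard n"
  define r where "r = complex_of_real (sqrt (2 ^ n))"
  have rr: "r * r = 2 ^ n"
    unfolding r_def by (metis of_real_mult of_real_numeral of_real_power real_sqrt_mult_self abs_numeral power_abs)
  have B1: "?I (B x) = x" if "x < ?N" for x
    using B that by (simp add: bij_betw_inv_into_left)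
  have re: "(\<Sum>v<?N. F v) = (\<Sum>x<?N. F (B x))" for F :: "nat \<Rightarrow> complex"
    by (rule sum.reindex_bij_betw[OF B, symmetric])
  have re2: "(\<Sum>v<?N. F v * (\<Sum>u<?N. G u * K v u)) = (\<Sum>y<?N. F (B y) * (\<Sum>x<?N. G (B x) * K (B y) (B x)))"
    for F G :: "nat \<Rightarrow> complex" and K
    using re[of "\<lambda>v. F v * (\<Sum>u<?N. G u * K v u)"] re[of "\<lambda>u. G u * K _ u"] by simp
  have "run_circuit [2 ^ n, 2 ^ n, 2 ^ n] n B (mac_circuit n) [w, 0, 0] [a, \<alpha>, \<beta>]
      = (\<Sum>v<?N. ?H \<beta> v * (\<Sum>u<?N. ?H \<alpha> u * (\<Sum>t<?N. ?H (?I u) t *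
           (if a = w \<and> t = 0 \<and> xor (xor (?I v) a) (?I u) = 0 then 1 else 0))))"
    by (simp add: run_circuit_def mac_circuit_def)
  also have "\<dots> = (\<Sum>y<?N. ?H \<beta> (B y) * (\<Sum>x<?N. ?H \<alpha> (B x) * (\<Sum>t<?N. ?H (?I (B x)) t *
           (if a = w \<and> t = 0 \<and> xor (xor (?I (B y)) a) (?I (B x)) = 0 then 1 else 0))))"
    by (rule re2[of "?H \<beta>" "?H \<alpha>"])
  also have "\<dots> = (\<Sum>y<?N. ?H \<beta> (B y) * (\<Sum>x<?N. ?H \<alpha> (B x) * (\<Sum>t<?N. if t = 0 then
           (if a = w \<and> x = xor y w then 1 / r else 0) else 0)))"
    by (intro sum.cong refl arg_cong2[where f = "(*)"])
       (auto simp: B1 xor_eq_0_iff_nat hadamard_def r_def)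
  also have "\<dots> = (\<Sum>y<?N. ?H \<beta> (B y) * (\<Sum>x<?N. if x = xor y w then ?H \<alpha> (B x) * (if a = w then 1 / r else 0) else 0))"
    by (intro sum.cong refl arg_cong2[where f = "(*)"]) auto
  also have "\<dots> = (\<Sum>y<?N. ?H \<beta> (B y) * (?H \<alpha> (B (xor y w)) * (if a = w then 1 / r else 0)))"
    using w by (intro sum.cong refl arg_cong2[where f = "(*)"]) (auto simp: xor_less_two_power)
  also have "\<dots> = (\<Sum>x<?N. ?H \<beta> (B (xor x w)) * (?H \<alpha> (B x) * (if a = w then 1 / r else 0)))"
    by (subst sum.reindex_bij_betw[OF bij_betw_xor[OF w], symmetric]) simp
  \<comment> \<open>Three Hadamard matrices contribute a factor \<open>1 / r\<close> each; one of
    these is the normalisation inside \<open>Cw\<close>.\<close>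
  also have "\<dots> = (\<Sum>x<?N. complex_of_real (mac_phase n B w \<alpha> \<beta> x) * (if a = w then 1 / (2 ^ n * r) else 0))"
    unfolding rr[symmetric]
    by (intro sum.cong refl) (simp add: hadamard_def mac_phase_def power_add r_def mult_ac)
  also have "\<dots> = (if a = w then complex_of_real (Cw n B w \<alpha> \<beta> / 2 ^ n) else 0)"
    by (simp add: Cw_def r_def sum_distrib_right[symmetric])
  finally show ?thesis .
qed

text \<open>Only basis states with \<open>w\<close> in register 0 have nonzero amplitude, so
  discarding this register merges no two outcomes of positive probability.\<close>

lemma pmf_mac_measure:
  assumes B: "bij_betw B {..<2 ^ n} {..<2 ^ n}" and w: "w < 2 ^ n"
  shows "pmf (mac_measure n B w) (\<alpha>, \<beta>)
    = (if \<alpha> < 2 ^ n \<and> \<beta> < 2 ^ n then (Cw n B w \<alpha> \<beta> / 2 ^ n)\<^sup>2 else 0)"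
proof -
  define ds where "ds = [2 ^ n, 2 ^ n, 2 ^ n :: nat]"
  define \<psi> where "\<psi> = run_circuit ds n B (mac_circuit n) [w, 0, 0]"
  have valid: "list_all (valid_gate ds n) (mac_circuit n)"
    by (simp add: ds_def mac_circuit_def unitary_matrix_hadamard)
  have s0: "[w, 0, 0] \<in> basis ds" using w by (auto simp: basis_def ds_def less_Suc_eq)
  have pmf: "pmf (measured ds \<psi>) s = (if s \<in> basis ds then (cmod (\<psi> s))\<^sup>2 else 0)" for s
    unfolding \<psi>_def by (rule pmf_measured[OF norm_run_circuit[OF B valid s0]])
  have amp: "\<psi> [a, \<alpha>, \<beta>] = (if a = w then complex_of_real (Cw n B w \<alpha> \<beta> / 2 ^ n) else 0)" for a \<alpha> \<beta>
    unfolding \<psi>_def ds_def by (rule mac_amplitude[OF B w])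
  have basis: "s \<in> basis ds \<longleftrightarrow> (\<exists>a x y. s = [a, x, y] \<and> a < 2 ^ n \<and> x < 2 ^ n \<and> y < 2 ^ n)" for s
    by (auto simp: basis_def ds_def less_Suc_eq length_Suc_conv numeral_3_eq_3)
  have eq: "(\<lambda>s. (s ! 1, s ! 2)) -` {(\<alpha>, \<beta>)} \<inter> set_pmf (measured ds \<psi>) = {[w, \<alpha>, \<beta>]} \<inter> set_pmf (measured ds \<psi>)"
    by (auto simp: set_pmf_eq pmf basis amp split: if_splits)
  have "pmf (mac_measure n B w) (\<alpha>, \<beta>) = measure (measured ds \<psi>) ((\<lambda>s. (s ! 1, s ! 2)) -` {(\<alpha>, \<beta>)})"
    by (simp add: mac_measure_def Let_def ds_def \<psi>_def pmf_map)
  also have "\<dots> = measure (measured ds \<psi>) {[w, \<alpha>, \<beta>]}"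
    using eq by (metis measure_Int_set_pmf)
  also have "\<dots> = (if \<alpha> < 2 ^ n \<and> \<beta> < 2 ^ n then (Cw n B w \<alpha> \<beta> / 2 ^ n)\<^sup>2 else 0)"
    using w by (simp add: measure_pmf_single pmf basis amp norm_divide power_divide norm_power)
  finally show ?thesis .
qed

lemma Cor_square: "(Cor n B w (\<alpha>, \<beta>))\<^sup>2 = (Cw n B w \<alpha> \<beta>)\<^sup>2 / 2 ^ n"
  by (simp add: Cor_def power_divide)

lemma Cor_eq_mean: "Cor n B w (\<alpha>, \<beta>) = (\<Sum>x<2 ^ n. mac_phase n B w \<alpha> \<beta> x) / 2 ^ n"
  by (simp add: Cor_def Cw_def)

lemma abs_mac_phase: "\<bar>mac_phase n B w \<alpha> \<beta> x\<bar> = 1"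
  by (simp add: mac_phase_def power_abs)

lemma abs_Cor_le_1: "\<bar>Cor n B w p\<bar> \<le> 1"
proof (cases p)
  case (Pair \<alpha> \<beta>)
  have "\<bar>\<Sum>x<2 ^ n. mac_phase n B w \<alpha> \<beta> x\<bar> \<le> (\<Sum>x<2 ^ n. \<bar>mac_phase n B w \<alpha> \<beta> x\<bar>)"
    by (rule sum_abs)
  then show ?thesis by (simp add: Pair Cor_eq_mean abs_mac_phase)
qed

text \<open>If one component is 0, the phase involves \<open>B\<close> at a single point. Since
  \<open>B\<close> is a bijection, the sum is then a full character sum, which vanishes unless the
  other component is 0 as well.\<close>

lemma Cw_zero:
  assumes B: "bij_betw B {..<2 ^ n} {..<2 ^ n}" and w: "w < 2 ^ n" and "\<alpha> < 2 ^ n" "\<beta> < 2 ^ n"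
    and "\<alpha> = 0 \<or> \<beta> = 0"
  shows "Cw n B w \<alpha> \<beta> = (if \<alpha> = 0 \<and> \<beta> = 0 then sqrt (2 ^ n) else 0)"
proof -
  have BX: "bij_betw (\<lambda>x. B (xor x w)) {..<2 ^ n} {..<2 ^ n}"
    using bij_betw_trans[OF bij_betw_xor[OF w] B] by (simp add: comp_def)
  have 1: "(\<Sum>x<2 ^ n. (- 1 :: real) ^ dot n c (B x)) = (if c = 0 then 2 ^ n else 0)" if "c < 2 ^ n" for c
    using sum.reindex_bij_betw[OF B, of "\<lambda>x. (- 1 :: real) ^ dot n c x"] sum_sign_dot[OF that, where ?'a = real]
    by (simp add: dot_commute)
  have 2: "(\<Sum>x<2 ^ n. (- 1 :: real) ^ dot n c (B (xor x w))) = (if c = 0 then 2 ^ n else 0)" if "c < 2 ^ n" for c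
    using sum.reindex_bij_betw[OF BX, of "\<lambda>x. (- 1 :: real) ^ dot n c x"] sum_sign_dot[OF that, where ?'a = real]
    by (simp add: dot_commute)
  show ?thesis
    using assms(3-5) 1[of \<alpha>] 2[of \<beta>]
    by (auto simp: Cw_def mac_phase_def real_div_sqrt)
qed

lemma mac_measure_zero_pairs:
  assumes B: "bij_betw B {..<2 ^ n} {..<2 ^ n}" and w: "w < 2 ^ n"
  shows "set_pmf (mac_measure n B w) \<inter> zero_pairs = {(0, 0)}"
    and "measure (mac_measure n B w) zero_pairs = 1 / 2 ^ n"
proof -
  have p0: "pmf (mac_measure n B w) (0, 0) = 1 / 2 ^ n"
    by (simp add: pmf_mac_measure[OF B w] Cw_zero[OF B w] power_divide power2_eq_square)
  show *: "set_pmf (mac_measure n B w) \<inter> zero_pairs = {(0, 0)}"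
    using p0 by (auto simp: set_pmf_eq zero_pairs_def pmf_mac_measure[OF B w] Cw_zero[OF B w] split: if_splits)
  have "measure (mac_measure n B w) zero_pairs = measure (mac_measure n B w) {(0, 0)}"
    using * measure_Int_set_pmf[of "mac_measure n B w" zero_pairs] by (simp add: Int_commute)
  then show "measure (mac_measure n B w) zero_pairs = 1 / 2 ^ n" by (simp add: measure_pmf_single p0)
qed

lemma set_mac_measure:
  assumes "bij_betw B {..<2 ^ n} {..<2 ^ n}" "w < 2 ^ n" "(\<alpha>, \<beta>) \<in> set_pmf (mac_measure n B w)"
  shows "\<alpha> < 2 ^ n" "\<beta> < 2 ^ n"
  using assms(3) by (auto simp: set_pmf_eq pmf_mac_measure[OF assms(1,2)] split: if_splits)

text \<open>\<open>Cor\<close> makes sense for all pairs while \<open>Vw\<close> is cut off at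
  \<open>2 ^ n\<close>; on the support of the measurement the two events agree.\<close>

lemma measure_mac_measure_Cor:
  assumes B: "bij_betw B {..<2 ^ n} {..<2 ^ n}" and w: "w < 2 ^ n"
  shows "measure (mac_measure n B w) {p. (Cor n B w p)\<^sup>2 \<ge> t} = adv n B w (2 ^ n * t)"
proof -
  let ?V = "Vw n B w (2 ^ n * t)"
  have fin: "finite ?V"
    by (rule finite_subset[of _ "{..<2 ^ n} \<times> {..<2 ^ n}"]) (auto simp: Vw_def)
  have "{p. (Cor n B w p)\<^sup>2 \<ge> t} \<inter> set_pmf (mac_measure n B w) = ?V \<inter> set_pmf (mac_measure n B w)"
    using set_mac_measure[OF B w] by (auto simp: Vw_def Cor_square field_simps)
  then have "measure (mac_measure n B w) {p. (Cor n B w p)\<^sup>2 \<ge> t} = measure (mac_measure n B w) ?V"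
    by (metis measure_Int_set_pmf)
  also have "\<dots> = (\<Sum>p\<in>?V. pmf (mac_measure n B w) p)"
    by (rule measure_measure_pmf_finite[OF fin])
  also have "\<dots> = (\<Sum>(\<alpha>, \<beta>)\<in>?V. 1 / (2 ^ n)\<^sup>2 * (Cw n B w \<alpha> \<beta>)\<^sup>2)"
    by (rule sum.cong) (auto simp: Vw_def pmf_mac_measure[OF B w] power_divide)
  also have "\<dots> = adv n B w (2 ^ n * t)"
    unfolding adv_def sum_distrib_left by (simp add: case_prod_beta)
  finally show ?thesis .
qed

section \<open>The tail of the Fejer kernel\<close>

text \<open>Moving the argument by one grid step \<open>pi / M\<close> exchanges one end term of the
  sum for another that differs from it by a full period.\<close>

lemma sum_shift_period:
  fixes h :: "real \<Rightarrow> real"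
  assumes M: "M > 0" and h: "\<And>x. h (x + pi) = h x"
  shows "(\<Sum>y<M. h (\<theta> + pi * of_int k / real M - pi * real y / real M)) = (\<Sum>y<M. h (\<theta> - pi * real y / real M))"
proof -
  have step: "(\<Sum>y<M. h (x + pi / real M - pi * real y / real M)) = (\<Sum>y<M. h (x - pi * real y / real M))" for x
  proof -
    let ?f = "\<lambda>y. h (x + pi / real M - pi * real y / real M)"
    have "(\<Sum>y<M. h (x - pi * real y / real M)) = (\<Sum>y<M. ?f (Suc y))"
      by (intro sum.cong refl arg_cong[where f = h]) (simp add: field_simps)
    also have "\<dots> = (\<Sum>y<M. ?f y) + ?f M - ?f 0"
      using sum.lessThan_Suc_shift[of ?f M] sum.lessThan_Suc[of ?f M] by simp
    also have "?f M = ?f 0" using h[of "x + pi / real M - pi"] M by simp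
    finally show ?thesis by simp
  qed
  have nat: "(\<Sum>y<M. h (x + pi * real m / real M - pi * real y / real M)) = (\<Sum>y<M. h (x - pi * real y / real M))" for x m
  proof (induction m arbitrary: x)
    case (Suc m)
    have "x + pi * real (Suc m) / real M = (x + pi / real M) + pi * real m / real M"
      by (simp add: distrib_left add_divide_distrib)
    then show ?case using Suc[of "x + pi / real M"] step[of x] by (simp only:)
  qed simp
  show ?thesis
  proof (cases "k \<ge> 0")
    case True
    then show ?thesis using nat[of \<theta> "nat k"] by simp
  next
    case False
    \<comment> \<open>A negative shift is a positive one seen from the shifted point.\<close>
    then show ?thesis using nat[of "\<theta> + pi * of_int k / real M" "nat (- k)"] by simp
  qed
qed

text \<open>Jordan's inequality: concavity puts the sine above its chord on the first quarter
  period, and the reflection of \<open>u\<close> to \<open>1 - u\<close> gives the other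
  half.\<close>

lemma sin_ge_jordan:
  assumes "0 \<le> u" "u \<le> 1"
  shows "sin (pi * u) \<ge> 2 * min u (1 - u)"
proof -
  have *: "sin (pi * v) \<ge> 2 * v" if v: "0 \<le> v" "v \<le> 1 / 2" for v :: real
  proof -
    have "concave_on {0..pi / 2} sin"
    proof (rule f''_le0_imp_concave)
      show "\<And>x. x \<in> {0..pi / 2} \<Longrightarrow> - sin x \<le> 0" using sin_ge_zero by simp
    qed (auto intro!: derivative_eq_intros)
    then have conc: "\<forall>x\<in>{0..pi / 2}. \<forall>y\<in>{0..pi / 2}. \<forall>u\<ge>0. \<forall>v\<ge>0. u + v = 1 \<longrightarrow>
        u * sin x + v * sin y \<le> sin (u * x + v * y)"
      unfolding concave_on_iff by simp
    have "(1 - 2 * v) * sin 0 + 2 * v * sin (pi / 2) \<le> sin ((1 - 2 * v) * 0 + 2 * v * (pi / 2))"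
      by (rule conc[rule_format]) (use v in auto)
    then show ?thesis by (simp add: mult.commute)
  qed
  show ?thesis
  proof (cases "u \<le> 1 / 2")
    case True then show ?thesis using *[of u] assms by simp
  next
    case False
    have "sin (pi * (1 - u)) = sin (pi * u)" by (simp add: right_diff_distrib sin_diff)
    then show ?thesis using *[of "1 - u"] assms False by simp
  qed
qed

text \<open>Telescoping, since \<open>1 / m ^ 2\<close> is at most
  \<open>1 / (m - 1) - 1 / m\<close>. The start at 5 matches the distance, in grid steps, that
  \<open>sum_far_le\<close> guarantees.\<close>

lemma sum_inverse_square_le:
  "(\<Sum>m\<in>{5..<K}. 1 / (real m)\<^sup>2) \<le> 1 / 4"
proof -
  have "(\<Sum>m\<in>{5..<5 + k}. 1 / (real m)\<^sup>2) \<le> 1 / 4 - 1 / (4 + real k)" for k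
  proof (induction k)
    case (Suc k)
    have "1 / (4 + real k) - 1 / (5 + real k) = 1 / ((5 + real k) * (4 + real k))"
      by (simp add: field_simps)
    moreover have "1 / (5 + real k)\<^sup>2 \<le> 1 / ((5 + real k) * (4 + real k))"
      unfolding power2_eq_square by (intro divide_left_mono mult_left_mono mult_pos_pos) auto
    ultimately have "1 / (5 + real k)\<^sup>2 \<le> 1 / (4 + real k) - 1 / (5 + real k)" by simp
    moreover have "(\<Sum>m\<in>{5..<5 + Suc k}. 1 / (real m)\<^sup>2) = (\<Sum>m\<in>{5..<5 + k}. 1 / (real m)\<^sup>2) + 1 / (5 + real k)\<^sup>2"
      unfolding add_Suc_right by (subst sum.atLeastLessThan_Suc) auto
    ultimately show ?case using Suc by (simp add: add.assoc[symmetric] del: sum.op_ivl_Suc)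
  qed simp
  from this[of "K - 5"] have "(\<Sum>m\<in>{5..<5 + (K - 5)}. 1 / (real m)\<^sup>2) \<le> 1 / 4"
    by (rule order_trans) simp
  then show ?thesis by (cases "K \<ge> 5") auto
qed

text \<open>A shift by whole grid steps reduces the angle to a fraction \<open>f\<close> of one
  step. A surviving point then lies more than five steps from both neighbouring multiples of
  \<open>pi\<close>, and Jordan's inequality bounds its term by \<open>1 / (4 * m ^ 2)\<close>, with
  \<open>m\<close> an integer below the distance to the nearer end. Each end contributes at most
  1/16.\<close>

lemma sum_far_le:
  assumes M: "M > 0"
  shows "(\<Sum>y<M. if \<bar>sin (\<theta> - pi * real y / real M)\<bar> > 16 / real M
            then 1 / (real M * sin (\<theta> - pi * real y / real M))\<^sup>2 else 0) \<le> 1 / 8"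
proof -
  define h where "h x = (if \<bar>sin x\<bar> > 16 / real M then 1 / (real M * sin x)\<^sup>2 else 0)" for x
  define t where "t = \<theta> * real M / pi"
  define f where "f = frac t"
  have f: "0 \<le> f" "f < 1" by (simp_all add: f_def frac_lt_1)
  have shift: "\<theta> + pi * of_int (- \<lfloor>t\<rfloor>) / real M = pi * f / real M"
    using M by (simp add: f_def frac_def t_def field_simps)
  have "(\<Sum>y<M. h (\<theta> - pi * real y / real M)) = (\<Sum>r<M. h (pi * f / real M - pi * real r / real M))"
    using sum_shift_period[OF M, of h \<theta> "- \<lfloor>t\<rfloor>"] unfolding shift by (simp add: h_def)
  also have "\<dots> \<le> (\<Sum>r<M. (if r \<ge> 6 then 1 / (4 * (real (r - 1))\<^sup>2) else 0)
                          + (if M - r \<ge> 5 then 1 / (4 * (real (M - r))\<^sup>2) else 0))"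
  proof (rule sum_mono)
    fix r assume r: "r \<in> {..<M}"
    define u where "u = (real r - f) / real M"
    let ?g = "(if r \<ge> 6 then 1 / (4 * (real (r - 1))\<^sup>2) else 0)
                          + (if M - r \<ge> 5 then 1 / (4 * (real (M - r))\<^sup>2) else 0 :: real)"
    have x: "pi * f / real M - pi * real r / real M = - (pi * u)"
      by (simp add: u_def field_simps diff_divide_distrib)
    have s: "\<bar>sin (- (pi * u))\<bar> = \<bar>sin (pi * u)\<bar>" by simp
    show "h (pi * f / real M - pi * real r / real M) \<le> ?g"
    proof (cases "\<bar>sin (pi * u)\<bar> > 16 / real M")
      case False then show ?thesis unfolding x by (simp add: h_def)
    next
      case far: True
      \<comment> \<open>The constant 3.2 exceeds \<open>pi\<close> and turns the threshold
        \<open>16 / M\<close> into exactly five grid steps.\<close>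
      have lip: "\<bar>sin (pi * v)\<bar> \<le> 3.2 * \<bar>v\<bar>" for v
      proof -
        have "\<bar>sin (pi * v)\<bar> \<le> pi * \<bar>v\<bar>" using abs_sin_x_le_abs_x[of "pi * v"] by (simp add: abs_mult)
        also have "\<dots> \<le> 3.2 * \<bar>v\<bar>" using pi_approx by (intro mult_right_mono) auto
        finally show ?thesis .
      qed
      have "16 / real M < 3.2 * \<bar>u\<bar>" using far lip[of u] by simp
      then have "5 < \<bar>u * real M\<bar>" using M by (simp add: field_simps abs_mult)
      then have r5: "real r - f > 5" using M f by (simp add: u_def abs_if split: if_splits)
      have "sin (pi * (1 - u)) = sin (pi * u)" by (simp add: right_diff_distrib sin_diff)
      then have "16 / real M < 3.2 * \<bar>1 - u\<bar>" using far lip[of "1 - u"] by simp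
      then have "5 < \<bar>(1 - u) * real M\<bar>" using M unfolding abs_mult by (simp add: field_simps)
      moreover have "(1 - u) * real M = real M - real r + f" using M by (simp add: u_def field_simps)
      ultimately have r4: "real M - real r + f > 5" using r f by (simp add: abs_if)
      \<comment> \<open>The two ends are not symmetric: the offset \<open>f\<close> in [0, 1)
        shortens the distance \<open>r - f\<close> to one end and lengthens the distance
        \<open>M - r + f\<close> to the other.\<close>
      have r6: "r \<ge> 6" using r5 f by linarith
      have r7: "M - r \<ge> 5" using r4 f r by linarith
      have u01: "0 \<le> u" "u \<le> 1" using r5 r f M by (auto simp: u_def field_simps)
      have pos: "real (r - 1) > 0" "real (M - r) > 0" using r6 r7 by auto
      have sge: "\<bar>sin (pi * u)\<bar> * real M \<ge> 2 * min (real (r - 1)) (real (M - r))"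
      proof -
        have "2 * min (real (r - 1)) (real (M - r)) \<le> 2 * min u (1 - u) * real M"
        proof -
          have "real (r - 1) \<le> u * real M" using M f r6 by (simp add: u_def)
          moreover have "real (M - r) \<le> (1 - u) * real M" using M f r by (simp add: u_def field_simps)
          ultimately show ?thesis using M by (auto simp: min_def)
        qed
        also have "\<dots> \<le> sin (pi * u) * real M" using sin_ge_jordan[OF u01] by (intro mult_right_mono) auto
        also have "\<dots> \<le> \<bar>sin (pi * u)\<bar> * real M" by (intro mult_right_mono) auto
        finally show ?thesis .
      qed
      have inv: "1 / (real M * sin (pi * u))\<^sup>2 \<le> 1 / (4 * m\<^sup>2)" if "0 < m" "2 * m \<le> \<bar>sin (pi * u)\<bar> * real M" for m
      proof -
        have "(2 * m)\<^sup>2 \<le> (\<bar>sin (pi * u)\<bar> * real M)\<^sup>2" using that by (intro power_mono) auto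
        then have le: "4 * m\<^sup>2 \<le> (real M * sin (pi * u))\<^sup>2" by (simp add: power_mult_distrib mult.commute)
        moreover have "0 < 4 * m\<^sup>2" using that(1) by simp
        ultimately have "0 < (real M * sin (pi * u))\<^sup>2" by linarith
        then show ?thesis using le \<open>0 < 4 * m\<^sup>2\<close> by (intro divide_left_mono mult_pos_pos) auto
      qed
      \<comment> \<open>The nearer end alone gives the bound; with both terms present the same
        expression serves for every \<open>r\<close>.\<close>
      have "1 / (real M * sin (pi * u))\<^sup>2 \<le> 1 / (4 * (real (r - 1))\<^sup>2) + 1 / (4 * (real (M - r))\<^sup>2)"
      proof (cases "real (r - 1) \<le> real (M - r)")
        case True
        then have "2 * real (r - 1) \<le> \<bar>sin (pi * u)\<bar> * real M" using sge by (simp add: min_def)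
        from inv[OF pos(1) this] show ?thesis by (simp add: add_increasing2)
      next
        case False
        then have "2 * real (M - r) \<le> \<bar>sin (pi * u)\<bar> * real M" using sge unfolding min_def by (simp only: if_False)
        from inv[OF pos(2) this] show ?thesis by (simp add: add_increasing)
      qed
      then show ?thesis using r6 r7 far unfolding x by (simp add: h_def)
    qed
  qed
  also have "\<dots> = (\<Sum>r<M. if r \<ge> 6 then 1 / (4 * (real (r - 1))\<^sup>2) else 0)
                 + (\<Sum>r<M. if M - r \<ge> 5 then 1 / (4 * (real (M - r))\<^sup>2) else 0)"
    by (rule sum.distrib)
  also have "(\<Sum>r<M. if r \<ge> 6 then 1 / (4 * (real (r - 1))\<^sup>2) else 0) = (\<Sum>m\<in>{5..<M - 1}. 1 / (real m)\<^sup>2) / 4"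
  proof -
    have "(\<Sum>r<M. if r \<ge> 6 then 1 / (4 * (real (r - 1))\<^sup>2) else 0) = (\<Sum>r\<in>{6..<M}. 1 / (4 * (real (r - 1))\<^sup>2))"
      by (rule sum.mono_neutral_cong_right) auto
    also have "\<dots> = (\<Sum>m\<in>{5..<M - 1}. 1 / (4 * (real m)\<^sup>2))"
      by (rule sum.reindex_bij_witness[of _ Suc "\<lambda>r. r - 1"]) auto
    finally show ?thesis unfolding sum_divide_distrib by (simp only: divide_divide_eq_left mult.commute)
  qed
  also have "(\<Sum>r<M. if M - r \<ge> 5 then 1 / (4 * (real (M - r))\<^sup>2) else 0) = (\<Sum>m\<in>{5..<M + 1}. 1 / (real m)\<^sup>2) / 4"
  proof -
    have "(\<Sum>r<M. if M - r \<ge> 5 then 1 / (4 * (real (M - r))\<^sup>2) else 0) = (\<Sum>r\<in>{r. r < M \<and> M - r \<ge> 5}. 1 / (4 * (real (M - r))\<^sup>2))"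
      by (rule sum.mono_neutral_cong_right) auto
    also have "\<dots> = (\<Sum>m\<in>{5..<M + 1}. 1 / (4 * (real m)\<^sup>2))"
      by (rule sum.reindex_bij_witness[of _ "\<lambda>m. M - m" "\<lambda>r. M - r"]) auto
    finally show ?thesis unfolding sum_divide_distrib by (simp only: divide_divide_eq_left mult.commute)
  qed
  finally have "(\<Sum>y<M. h (\<theta> - pi * real y / real M)) \<le> 1 / 8"
    using sum_inverse_square_le[of "M - 1"] sum_inverse_square_le[of "M + 1"] by linarith
  then show ?thesis by (simp add: h_def)
qed

text \<open>The left side is a Fejer kernel. Summing the series and using that
  \<open>1 - cis y\<close> has modulus \<open>2 * \<bar>sin (y / 2)\<bar>\<close> gives the quotient
  of \<open>sin (M * x)\<close> by \<open>M * sin x\<close>, squared; where the sine vanishes only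
  the trivial bound remains.\<close>

lemma geometric_cis_le:
  "(cmod (\<Sum>k<M. cis (2 * x) ^ k) / real M)\<^sup>2 \<le> (if sin x = 0 then 1 else 1 / (real M * sin x)\<^sup>2)"
proof (cases "sin x = 0")
  case True
  have "cmod (\<Sum>k<M. cis (2 * x) ^ k) \<le> (\<Sum>k<M. cmod (cis (2 * x) ^ k))" by (rule norm_sum)
  then have "cmod (\<Sum>k<M. cis (2 * x) ^ k) \<le> real M" by (simp add: norm_power)
  then have "cmod (\<Sum>k<M. cis (2 * x) ^ k) / real M \<le> 1" by (cases "M = 0") (auto simp: field_simps)
  then show ?thesis using True by (simp add: power_le_one)
next
  case False
  have c: "cmod (1 - cis y) = 2 * \<bar>sin (y / 2)\<bar>" for y :: real
  proof -
    have "(cmod (1 - cis y))\<^sup>2 = (1 - cos y)\<^sup>2 + (sin y)\<^sup>2" by (simp add: cmod_power2)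
    also have "\<dots> = 2 - 2 * cos y" using sin_cos_squared_add[of y] by (simp add: power2_diff)
    also have "cos y = 1 - 2 * (sin (y / 2))\<^sup>2" using cos_double_sin[of "y / 2"] by simp
    finally have "(cmod (1 - cis y))\<^sup>2 = (2 * \<bar>sin (y / 2)\<bar>)\<^sup>2" by (simp add: power_mult_distrib)
    then show ?thesis by (rule power2_eq_imp_eq) auto
  qed
  have "cmod (\<Sum>k<M. cis (2 * x) ^ k) * (2 * \<bar>sin x\<bar>) = cmod (1 - cis (2 * x) ^ M)"
    using c[of "2 * x"] by (metis norm_mult mult.commute one_diff_power_eq nonzero_mult_div_cancel_left zero_neq_numeral)
  also have "\<dots> = 2 * \<bar>sin (real M * x)\<bar>" using c[of "real M * (2 * x)"] by (simp add: Complex.DeMoivre)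
  finally have e: "cmod (\<Sum>k<M. cis (2 * x) ^ k) * \<bar>sin x\<bar> = \<bar>sin (real M * x)\<bar>" by simp
  then have "cmod (\<Sum>k<M. cis (2 * x) ^ k) = \<bar>sin (real M * x)\<bar> / \<bar>sin x\<bar>"
    using False by (simp add: field_simps)
  then have "(cmod (\<Sum>k<M. cis (2 * x) ^ k) / real M)\<^sup>2 = (sin (real M * x))\<^sup>2 / (real M * sin x)\<^sup>2"
    by (simp add: power_divide power_mult_distrib mult.commute)
  also have "\<dots> \<le> 1 / (real M * sin x)\<^sup>2"
    by (intro divide_right_mono) (auto simp: abs_square_le_1)
  finally show ?thesis using False by simp
qed

section \<open>Rejection, repetition and amplification\<close>

text \<open>The probability \<open>x\<close> of never returning satisfies
  \<open>x = measure rej * x\<close>, so it is 0 unless rejection is certain.\<close>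

lemma lossless_macsample:
  assumes "measure (mac_measure n B w) rej < 1"
  shows "lossless_spmf (macsample rej n B w)"
proof -
  let ?x = "pmf (macsample rej n B w) None"
  have "?x = (\<integral>p. indicator rej p * ?x \<partial>mac_measure n B w)"
    by (subst macsample.simps, subst bind_spmf_of_pmf, subst pmf_bind, intro Bochner_Integration.integral_cong refl)
       (auto simp: pmf_None_eq_weight_spmf)
  also have "\<dots> = measure (mac_measure n B w) rej * ?x" by simp
  finally have "?x * (1 - measure (mac_measure n B w) rej) = 0" by (simp add: algebra_simps)
  then show ?thesis using assms by (simp add: lossless_iff_pmf_None)
qed

lemma circuit_queries_mac [simp]: "circuit_queries (mac_circuit n) = 2"
  by (simp add: circuit_queries_def mac_circuit_def)

lemma spmf_of_pmf_inject: "spmf_of_pmf p = spmf_of_pmf q \<longleftrightarrow> p = q"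
  by (metis pmf_eqI spmf_spmf_of_pmf)

text \<open>Almost sure termination allows the recursion to be restated as a fixed point equation
  for an ordinary distribution, the form in which the next two lemmas use it.\<close>

lemma macsample_pmf:
  assumes "measure (mac_measure n B w) rej < 1"
  obtains P where "macsample rej n B w = spmf_of_pmf P"
    "P = bind_pmf (mac_measure n B w) (\<lambda>p. if p \<in> rej then map_pmf (\<lambda>(p', q). (p', 2 + q)) P else return_pmf (p, 2))"
proof -
  obtain P where P: "macsample rej n B w = spmf_of_pmf P"
    using lossless_macsample[OF assms] by (auto simp: lossless_spmf_conv_spmf_of_pmf)
  have "spmf_of_pmf P = bind_pmf (mac_measure n B w)
      (\<lambda>p. if p \<in> rej then map_spmf (\<lambda>(p', q). (p', 2 + q)) (spmf_of_pmf P) else return_spmf (p, 2))"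
    using macsample.simps[of rej n B w] unfolding P circuit_queries_mac bind_spmf_of_pmf .
  also have "\<dots> = spmf_of_pmf (bind_pmf (mac_measure n B w)
      (\<lambda>p. if p \<in> rej then map_pmf (\<lambda>(p', q). (p', 2 + q)) P else return_pmf (p, 2)))"
    unfolding spmf_of_pmf_bind by (intro bind_pmf_cong refl) simp
  finally show ?thesis using that P by (simp only: spmf_of_pmf_inject)
qed

text \<open>The recursion makes the probability \<open>x\<close> of the event satisfy
  \<open>x = measure M R * x + measure M (E - R)\<close>, which is solved for \<open>x\<close>: the
  accepted draw follows \<open>M\<close> conditioned on acceptance.\<close>

lemma rejection_measure:
  fixes c :: nat and M :: "'a pmf"
  assumes P: "P = bind_pmf M (\<lambda>p. if p \<in> R then map_pmf (\<lambda>(p', q). (p', c + q)) P else return_pmf (p, c))"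
    and R: "measure M R < 1"
  shows "measure P {(p, q). p \<in> E} = measure M (E - R) / (1 - measure M R)"
proof -
  let ?x = "measure P {(p, q). p \<in> E}"
  have "ennreal ?x = emeasure P {(p, q). p \<in> E}" by (simp add: measure_pmf.emeasure_eq_measure)
  also have "\<dots> = (\<integral>\<^sup>+ p. (indicator R p * ennreal ?x + indicator (E - R) p) \<partial>M)"
    by (subst P, subst emeasure_bind_pmf, intro nn_integral_cong)
       (auto simp: measure_pmf.emeasure_eq_measure indicator_def vimage_def case_prod_unfold split: if_splits)
  also have "\<dots> = emeasure M R * ennreal ?x + emeasure M (E - R)"
    by (subst nn_integral_add) (auto simp: nn_integral_multc)
  also have "\<dots> = ennreal (measure M R * ?x + measure M (E - R))"
    by (simp add: measure_pmf.emeasure_eq_measure ennreal_mult ennreal_plus)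
  finally have "?x = measure M R * ?x + measure M (E - R)"
    by (subst (asm) ennreal_inj) auto
  then show ?thesis using R by (simp add: field_simps)
qed

text \<open>The expected cost should solve \<open>E = c + measure M R * E\<close>, and rejection
  with probability at most 1/2 then gives at most \<open>2 * c\<close>.\<close>

lemma rejection_cost:
  fixes c :: nat and M :: "'a pmf"
  assumes P: "P = bind_pmf M (\<lambda>p. if p \<in> R then map_pmf (\<lambda>(p', q). (p', c + q)) P else return_pmf (p, c))"
    and R: "measure M R \<le> 1 / 2"
  shows "(\<integral>\<^sup>+ x. ennreal (real (snd x)) \<partial>P) \<le> ennreal (2 * real c)"
proof -
  \<comment> \<open>Truncating the cost keeps the fixed point equation from being solved by infinity.\<close>
  have trunc: "(\<integral>\<^sup>+ x. ennreal (real (min (snd x) K)) \<partial>P) \<le> ennreal (2 * real c)" for K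
  proof -
    let ?I = "\<integral>\<^sup>+ x. ennreal (real (min (snd x) K)) \<partial>P"
    have "?I \<le> (\<integral>\<^sup>+ x. ennreal (real K) \<partial>P)" by (intro nn_integral_mono ennreal_leI) auto
    then have "?I < \<infinity>" by (simp add: le_less_trans)
    then obtain i where i: "0 \<le> i" "?I = ennreal i" by (cases ?I) auto
    have "?I \<le> (\<integral>\<^sup>+ p. (ennreal (real c) + indicator R p * ?I) \<partial>M)"
    proof (subst P, subst nn_integral_bind_pmf, intro nn_integral_mono)
      fix p
      have "(\<integral>\<^sup>+ x. ennreal (real (min (c + snd x) K)) \<partial>P) \<le> (\<integral>\<^sup>+ x. (ennreal (real c) + ennreal (real (min (snd x) K))) \<partial>P)"
        by (intro nn_integral_mono) (auto simp: ennreal_plus[symmetric] simp del: ennreal_plus intro!: ennreal_leI)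
      also have "\<dots> = ennreal (real c) + ?I" by (subst nn_integral_add) auto
      finally show "(\<integral>\<^sup>+ x. ennreal (real (min (snd x) K)) \<partial>(if p \<in> R then map_pmf (\<lambda>(p', q). (p', c + q)) P else return_pmf (p, c)))
          \<le> ennreal (real c) + indicator R p * ?I"
        by (auto simp: case_prod_beta intro!: ennreal_leI)
    qed
    also have "\<dots> = ennreal (real c) + emeasure M R * ?I"
      by (subst nn_integral_add) (auto simp: nn_integral_multc)
    also have "\<dots> = ennreal (real c + measure M R * i)"
      unfolding i using i by (simp add: measure_pmf.emeasure_eq_measure ennreal_mult)
    finally have "i \<le> real c + measure M R * i" unfolding i by (subst (asm) ennreal_le_iff) (use i in auto)
    also have "\<dots> \<le> real c + 1 / 2 * i" using R i by (intro add_left_mono mult_right_mono) auto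
    finally show ?thesis unfolding i by (intro ennreal_leI) simp
  qed
  \<comment> \<open>The truncated bound is uniform in \<open>K\<close>, so monotone convergence
    removes the truncation.\<close>
  have "(\<integral>\<^sup>+ x. ennreal (real (snd x)) \<partial>P) = (\<integral>\<^sup>+ x. (SUP K. ennreal (real (min (snd x) K))) \<partial>P)"
  proof (intro nn_integral_cong antisym)
    fix x :: "'a \<times> nat"
    show "ennreal (real (snd x)) \<le> (SUP K. ennreal (real (min (snd x) K)))"
      by (rule SUP_upper2[of "snd x"]) auto
    show "(SUP K. ennreal (real (min (snd x) K))) \<le> ennreal (real (snd x))"
      by (rule SUP_least) (auto intro!: ennreal_leI)
  qed
  also have "\<dots> = (SUP K. \<integral>\<^sup>+ x. ennreal (real (min (snd x) K)) \<partial>P)"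
    by (intro nn_integral_monotone_convergence_SUP) (auto simp: incseq_def le_fun_def intro!: ennreal_leI)
  also have "\<dots> \<le> ennreal (2 * real c)" by (intro SUP_least trunc)
  finally show ?thesis .
qed

section \<open>Independent repetition\<close>

lemma repeat_spmf_of_pmf: "repeat_spmf k (spmf_of_pmf p) = spmf_of_pmf (replicate_pmf k p)"
proof (induction k)
  case (Suc k)
  then show ?case by (simp add: spmf_of_pmf_bind)
qed simp

lemma prob_replicate_pmf_all:
  fixes p :: "'a pmf"
  shows "measure (replicate_pmf k p) {xs. \<forall>x\<in>set xs. x \<in> A} = measure p A ^ k"
proof -
  have "emeasure (replicate_pmf k p) {xs. \<forall>x\<in>set xs. x \<in> A} = emeasure p A ^ k"
  proof (induction k)
    case (Suc k)
    have "emeasure (replicate_pmf (Suc k) p) {xs. \<forall>x\<in>set xs. x \<in> A}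
        = (\<integral>\<^sup>+ x. (\<integral>\<^sup>+ xs. indicator A x * indicator {xs. \<forall>x\<in>set xs. x \<in> A} xs \<partial>replicate_pmf k p) \<partial>p)"
      unfolding replicate_pmf.simps emeasure_bind_pmf
      by (intro nn_integral_cong) (auto simp: indicator_def)
    also have "\<dots> = emeasure p A * emeasure (replicate_pmf k p) {xs. \<forall>x\<in>set xs. x \<in> A}"
      by (simp add: nn_integral_cmult nn_integral_multc)
    finally show ?case using Suc by simp
  qed simp
  then have "ennreal (measure (replicate_pmf k p) {xs. \<forall>x\<in>set xs. x \<in> A}) = ennreal (measure p A ^ k)"
    by (simp add: measure_pmf.emeasure_eq_measure ennreal_power)
  then show ?thesis by (subst (asm) ennreal_inj) auto
qed

lemma nn_integral_replicate_pmf_sum: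
  fixes f :: "'a \<Rightarrow> nat" and p :: "'a pmf"
  shows "(\<integral>\<^sup>+ xs. ennreal (real (\<Sum>x\<leftarrow>xs. f x)) \<partial>replicate_pmf k p) = of_nat k * (\<integral>\<^sup>+ x. ennreal (real (f x)) \<partial>p)"
proof (induction k)
  case (Suc k)
  have "(\<integral>\<^sup>+ xs. ennreal (real (\<Sum>x\<leftarrow>xs. f x)) \<partial>replicate_pmf (Suc k) p)
      = (\<integral>\<^sup>+ x. (\<integral>\<^sup>+ xs. ennreal (real (f x)) + ennreal (real (\<Sum>x\<leftarrow>xs. f x)) \<partial>replicate_pmf k p) \<partial>p)"
    unfolding replicate_pmf.simps nn_integral_bind_pmf by (intro nn_integral_cong) simp
  also have "\<dots> = (\<integral>\<^sup>+ x. ennreal (real (f x)) \<partial>p) + (\<integral>\<^sup>+ xs. ennreal (real (\<Sum>x\<leftarrow>xs. f x)) \<partial>replicate_pmf k p)"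
    by (simp add: nn_integral_add)
  finally show ?case by (simp add: Suc distrib_right)
qed simp

text \<open>Two failures are combined by the union bound. With \<open>k\<close> at least
  \<open>6 / a\<close>, the product of \<open>k\<close> and the chance of \<open>G\<close> is at
  least 4, so \<open>G\<close> is missed throughout with probability at most exp (-4), which is
  below 1/5. The expected total is at most \<open>7 * m / a\<close>, since rounding
  \<open>6 / a\<close> up costs at most \<open>1 / a\<close>; Markov's inequality at ten times this
  value leaves 1/10. Together 3/10 stays below 1/3.\<close>

lemma amplification:
  fixes f :: "'a \<Rightarrow> nat" and p :: "'a pmf"
  assumes g: "measure p G \<ge> 2 / 3 * a" and a: "0 < a" "a \<le> 1"
    and m: "(\<integral>\<^sup>+ x. ennreal (real (f x)) \<partial>p) \<le> ennreal m" "0 \<le> m" and T: "70 * m / a \<le> T" "0 < T"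
  defines "k \<equiv> nat \<lceil>6 / a\<rceil>"
  shows "real k \<le> 7 / a"
    and "(\<integral>\<^sup>+ xs. ennreal (real (\<Sum>x\<leftarrow>xs. f x)) \<partial>replicate_pmf k p) \<le> ennreal (7 / a * m)"
    and "measure (replicate_pmf k p) {xs. real (\<Sum>x\<leftarrow>xs. f x) \<le> T \<and> (\<exists>x\<in>set xs. x \<in> G)} \<ge> 2 / 3"
proof -
  have "6 / a \<ge> 0" using a by simp
  then have k1: "real k \<ge> 6 / a" "real k \<le> 6 / a + 1" unfolding k_def by linarith+
  have "1 \<le> 1 / a" using a by simp
  then have "6 / a + 1 \<le> 7 / a" by (simp add: field_simps)
  with k1 show k2: "real k \<le> 7 / a" by linarith
  let ?S = "\<lambda>xs. \<Sum>x\<leftarrow>xs. f x"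
  have "of_nat k * (\<integral>\<^sup>+ x. ennreal (real (f x)) \<partial>p) \<le> ennreal (real k) * ennreal m"
    using m(1) by (simp add: ennreal_of_nat_eq_real_of_nat mult_left_mono)
  also have "\<dots> = ennreal (real k * m)" using m by (simp add: ennreal_mult)
  also have "\<dots> \<le> ennreal (7 / a * m)" using k2 m by (intro ennreal_leI mult_right_mono) auto
  finally show E: "(\<integral>\<^sup>+ xs. ennreal (real (?S xs)) \<partial>replicate_pmf k p) \<le> ennreal (7 / a * m)"
    by (simp only: nn_integral_replicate_pmf_sum)
  have "emeasure (replicate_pmf k p) {xs. \<not> real (?S xs) \<le> T}
      \<le> emeasure (replicate_pmf k p) ({xs \<in> UNIV. 1 \<le> ennreal (1 / T) * ennreal (real (?S xs))})"
    using T by (intro emeasure_mono) (auto simp: ennreal_mult[symmetric] field_simps simp flip: ennreal_1 intro!: ennreal_leI)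
  also have "\<dots> \<le> ennreal (1 / T) * (\<integral>\<^sup>+ xs. ennreal (real (?S xs)) * indicator UNIV xs \<partial>replicate_pmf k p)"
    by (rule nn_integral_Markov_inequality) auto
  also have "\<dots> \<le> ennreal (1 / T) * ennreal (7 / a * m)"
    using E by (intro mult_left_mono) auto
  also have "\<dots> = ennreal (7 * m / (a * T))" using T a m by (simp add: ennreal_mult[symmetric])
  finally have "measure (replicate_pmf k p) {xs. \<not> real (?S xs) \<le> T} \<le> 7 * m / (a * T)"
    using T a m by (simp add: measure_pmf.emeasure_eq_measure)
  also have "\<dots> \<le> 1 / 10"
    using T a by (simp add: field_simps)
  finally have cost: "measure (replicate_pmf k p) {xs. \<not> real (?S xs) \<le> T} \<le> 1 / 10" .
  have "measure (replicate_pmf k p) {xs. \<forall>x\<in>set xs. x \<in> - G} = (1 - measure p G) ^ k"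
    unfolding prob_replicate_pmf_all using measure_pmf.prob_compl[of G p] by (simp add: Compl_eq_Diff_UNIV)
  also have "\<dots> \<le> exp (- measure p G) ^ k"
    using exp_ge_add_one_self[of "- measure p G"] by (intro power_mono) auto
  also have "\<dots> = exp (- (real k * measure p G))" by (simp add: exp_of_nat_mult[symmetric])
  also have "\<dots> \<le> exp (- 4)"
  proof -
    have "4 = 6 / a * (2 / 3 * a)" using a by simp
    also have "\<dots> \<le> real k * measure p G" using k1 g a by (intro mult_mono) auto
    finally show ?thesis by simp
  qed
  also have "\<dots> \<le> 1 / 5" using exp_ge_add_one_self[of "4 :: real"] by (simp add: exp_minus field_simps)
  finally have bad: "measure (replicate_pmf k p) {xs. \<forall>x\<in>set xs. x \<in> - G} \<le> 1 / 5" .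
  let ?A = "{xs. real (?S xs) \<le> T \<and> (\<exists>x\<in>set xs. x \<in> G)}"
  have "measure (replicate_pmf k p) (- ?A)
      \<le> measure (replicate_pmf k p) ({xs. \<not> real (?S xs) \<le> T} \<union> {xs. \<forall>x\<in>set xs. x \<in> - G})"
    by (intro measure_pmf.finite_measure_mono) auto
  also have "\<dots> \<le> 1 / 10 + 1 / 5"
    by (rule order_trans[OF measure_Un_le]) (use cost bad in auto)
  finally have "measure (replicate_pmf k p) (- ?A) \<le> 3 / 10" by simp
  then show "measure (replicate_pmf k p) ?A \<ge> 2 / 3"
    using measure_pmf.prob_compl[of ?A "replicate_pmf k p"] by (simp add: Compl_eq_Diff_UNIV)
qed

text \<open>Variances of independent centred samples add: the cross term of
  \<open>(h a + S)\<^sup>2\<close> is linear in the remaining sum \<open>S\<close>, whose mean is 0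
  by the second claim. Finite support makes everything integrable.\<close>

lemma second_moment_replicate_pmf:
  fixes h :: "'a \<Rightarrow> real" and p :: "'a pmf"
  assumes fin: "finite (set_pmf p)" and h0: "measure_pmf.expectation p h = 0"
  shows "measure_pmf.expectation (replicate_pmf k p) (\<lambda>xs. (\<Sum>x\<leftarrow>xs. h x)\<^sup>2)
      = real k * measure_pmf.expectation p (\<lambda>x. (h x)\<^sup>2)"
    and "measure_pmf.expectation (replicate_pmf k p) (\<lambda>xs. \<Sum>x\<leftarrow>xs. h x) = 0"
proof -
  let ?S = "\<lambda>xs. \<Sum>x\<leftarrow>xs. h x"
  let ?E = "\<lambda>k. measure_pmf.expectation (replicate_pmf k p)"
  have fr: "finite (set_pmf (replicate_pmf k p))" for k
    by (rule finite_subset[OF _ finite_lists_length_eq[OF fin, of k]]) (auto simp: set_replicate_pmf)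
  have int: "integrable (measure_pmf (replicate_pmf k p)) F" for k and F :: "'a list \<Rightarrow> real"
    using fr by (rule integrable_measure_pmf_finite)
  have exp_p: "measure_pmf.expectation p F = (\<Sum>a\<in>set_pmf p. pmf p a * F a)" for F :: "'a \<Rightarrow> real"
    by (subst integral_measure_pmf[OF fin]) auto
  have step: "?E (Suc k) F = (\<Sum>a\<in>set_pmf p. pmf p a * ?E k (\<lambda>xs. F (a # xs)))" for k and F :: "'a list \<Rightarrow> real"
  proof -
    have "replicate_pmf (Suc k) p = bind_pmf p (\<lambda>a. map_pmf ((#) a) (replicate_pmf k p))"
      by (simp add: map_pmf_def)
    then show ?thesis using fin fr by (simp add: pmf_expectation_bind[OF fin])
  qed
  show S0: "?E k ?S = 0" for k
  proof (induction k)
    case (Suc k)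
    then show ?case using h0 int by (simp add: step exp_p del: replicate_pmf.simps)
  qed simp
  show "?E k (\<lambda>xs. (?S xs)\<^sup>2) = real k * measure_pmf.expectation p (\<lambda>x. (h x)\<^sup>2)"
  proof (induction k)
    case (Suc k)
    have "?E k (\<lambda>xs. (h a + ?S xs)\<^sup>2) = (h a)\<^sup>2 + ?E k (\<lambda>xs. (?S xs)\<^sup>2)" for a
      using int S0[of k] by (simp add: power2_sum)
    then have "?E (Suc k) (\<lambda>xs. (?S xs)\<^sup>2) = (\<Sum>a\<in>set_pmf p. pmf p a * ((h a)\<^sup>2 + ?E k (\<lambda>xs. (?S xs)\<^sup>2)))"
      by (simp add: step del: replicate_pmf.simps)
    also have "\<dots> = measure_pmf.expectation p (\<lambda>x. (h x)\<^sup>2) + (\<Sum>a\<in>set_pmf p. pmf p a) * ?E k (\<lambda>xs. (?S xs)\<^sup>2)"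
      by (simp add: exp_p distrib_left sum.distrib sum_distrib_right)
    also have "(\<Sum>a\<in>set_pmf p. pmf p a) = 1" using fin by (intro sum_pmf_eq_1) auto
    finally show ?case by (simp add: Suc distrib_right)
  qed simp
qed

section \<open>Amplitude estimation\<close>

locale amplitude_test =
  fixes n M :: nat and B :: "nat \<Rightarrow> nat" and w \<alpha> \<beta> :: nat
  assumes B: "bij_betw B {..<2 ^ n} {..<2 ^ n}" and w: "w < 2 ^ n" and M: "M > 0"
begin

abbreviation "dims \<equiv> [2 ^ n, 2 ^ n, 2 ^ n, 2, M]"
abbreviation "run c \<psi> \<equiv> fold (apply_gate dims n B) c \<psi>"
abbreviation "phase x \<equiv> complex_of_real (mac_phase n B w \<alpha> \<beta> x)"

text \<open>Register 0 stays at \<open>w\<close> and register 2 returns to 0, so a state is given by its amplitudes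
  \<open>\<phi> j x q\<close> in registers 4, 1 and 3.\<close>

definition slice :: "state \<Rightarrow> (nat \<Rightarrow> nat \<Rightarrow> nat \<Rightarrow> complex) \<Rightarrow> bool" where
  "slice \<psi> \<phi> \<longleftrightarrow> (\<forall>a<2 ^ n. \<forall>x<2 ^ n. \<forall>z<2 ^ n. \<forall>q<2. \<forall>j<M.
     \<psi> [a, x, z, q, j] = (if a = w \<and> z = 0 then \<phi> j x q else 0))"

text \<open>At a fixed counter value a slice is a function of registers 1 and 3. This operator and
  the following ones are the actions of the gates of the Hadamard test on such functions.\<close>

definition had1 :: "(nat \<Rightarrow> nat \<Rightarrow> complex) \<Rightarrow> nat \<Rightarrow> nat \<Rightarrow> complex" where
  "had1 \<phi> = (\<lambda>x q. \<Sum>v<2 ^ n. hadamard n x v * \<phi> v q)"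

definition had3 :: "(nat \<Rightarrow> nat \<Rightarrow> complex) \<Rightarrow> nat \<Rightarrow> nat \<Rightarrow> complex" where
  "had3 \<phi> = (\<lambda>x q. \<Sum>v<2. hadamard 1 q v * \<phi> x v)"

definition cphase :: "(nat \<Rightarrow> nat \<Rightarrow> complex) \<Rightarrow> nat \<Rightarrow> nat \<Rightarrow> complex" where
  "cphase \<phi> = (\<lambda>x q. (if q = 1 then phase x else 1) * \<phi> x q)"

definition test :: "(nat \<Rightarrow> nat \<Rightarrow> complex) \<Rightarrow> nat \<Rightarrow> nat \<Rightarrow> complex" where
  "test \<phi> = had3 (cphase (had1 (had3 \<phi>)))"

definition test_adj :: "(nat \<Rightarrow> nat \<Rightarrow> complex) \<Rightarrow> nat \<Rightarrow> nat \<Rightarrow> complex" where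
  "test_adj \<phi> = had3 (had1 (cphase (had3 \<phi>)))"

lemma slice_cong:
  assumes "slice \<psi> \<phi>" "\<And>j x q. j < M \<Longrightarrow> x < 2 ^ n \<Longrightarrow> q < 2 \<Longrightarrow> \<phi> j x q = \<phi>' j x q"
  shows "slice \<psi> \<phi>'"
  using assms unfolding slice_def by auto

lemma slice_Local1:
  assumes "slice \<psi> \<phi>"
  shows "slice (apply_gate dims n B (Local 1 (hadamard n)) \<psi>) (\<lambda>j. had1 (\<phi> j))"
  using assms unfolding slice_def had1_def by (auto intro!: sum.neutral)

lemma slice_Local3:
  assumes "slice \<psi> \<phi>"
  shows "slice (apply_gate dims n B (Local 3 (hadamard 1)) \<psi>) (\<lambda>j. had3 (\<phi> j))"
  using assms unfolding slice_def had3_def by (auto intro!: sum.neutral)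

lemma slice_Local4:
  assumes "slice \<psi> \<phi>"
  shows "slice (apply_gate dims n B (Local 4 G) \<psi>) (\<lambda>j x q. \<Sum>v<M. G j v * \<phi> v x q)"
  using assms unfolding slice_def by (auto intro!: sum.neutral)

lemma slice_Diag:
  assumes "slice \<psi> \<phi>"
  shows "slice (apply_gate dims n B (Diag d) \<psi>) (\<lambda>j x q. d [w, x, 0, q, j] * \<phi> j x q)"
  using assms unfolding slice_def by auto

lemma inv_B [simp]: "x < 2 ^ n \<Longrightarrow> inv_into {..<2 ^ n} B (B x) = x"
  using B by (simp add: bij_betw_inv_into_left)

text \<open>Uncomputation makes the block diagonal on every basis state, also for \<open>z\<close>
  other than 0, so amplitudes off the slice remain 0.\<close>

lemma run_controlled_phase:
  assumes "a < 2 ^ n" "x < 2 ^ n" "z < 2 ^ n"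
  shows "run (controlled_phase n \<alpha> \<beta>) \<psi> [a, x, z, q, j]
    = (if q = 1 then (- 1) ^ (dot n \<alpha> (B x) + dot n \<beta> (B (xor (xor z x) a))) else 1) * \<psi> [a, x, z, q, j]"
  using assms by (simp add: controlled_phase_def xor_less_two_power)

lemma slice_controlled_phase:
  assumes "slice \<psi> \<phi>"
  shows "slice (run (controlled_phase n \<alpha> \<beta>) \<psi>) (\<lambda>j. cphase (\<phi> j))"
  using assms unfolding slice_def cphase_def
  by (auto simp: run_controlled_phase mac_phase_def)

text \<open>The block is a palindrome up to exchanging each oracle gate with its adjoint, around a
  diagonal gate with real entries.\<close>

lemma adj_controlled_phase: "adj (controlled_phase n \<alpha> \<beta>) = controlled_phase n \<alpha> \<beta>"
  by (simp add: adj_def controlled_phase_def if_distrib[of cnj] cong: if_cong)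

lemma adj_hadamard_test:
  "adj (hadamard_test n \<alpha> \<beta>)
    = [Local 3 (hadamard 1)] @ controlled_phase n \<alpha> \<beta> @ [Local 1 (hadamard n), Local 3 (hadamard 1)]"
proof -
  have adj_append: "adj (c @ d) = adj d @ adj c" for c d by (simp add: adj_def)
  have h: "adj [Local i (hadamard m)] = [Local i (hadamard m)]" for i m
    by (simp add: adj_def hadamard_commute[of m])
  have e: "hadamard_test n \<alpha> \<beta> = [Local 3 (hadamard 1)] @ [Local 1 (hadamard n)] @ controlled_phase n \<alpha> \<beta> @ [Local 3 (hadamard 1)]"
    by (simp add: hadamard_test_def)
  show ?thesis unfolding e adj_append h adj_controlled_phase by simp
qed

lemma slice_hadamard_test:
  assumes "slice \<psi> \<phi>"
  shows "slice (run (hadamard_test n \<alpha> \<beta>) \<psi>) (\<lambda>j. test (\<phi> j))"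
  unfolding hadamard_test_def test_def fold_append fold.simps comp_def id_def
  by (rule slice_Local3 slice_Local1 slice_controlled_phase assms)+

lemma slice_adj_hadamard_test:
  assumes "slice \<psi> \<phi>"
  shows "slice (run (adj (hadamard_test n \<alpha> \<beta>)) \<psi>) (\<lambda>j. test_adj (\<phi> j))"
  unfolding adj_hadamard_test test_adj_def fold_append fold.simps comp_def id_def
  by (rule slice_Local3 slice_Local1 slice_controlled_phase assms)+

section \<open>The Hadamard test, its inverse and the Grover step on slices\<close>

lemma had3_had3: "q < 2 \<Longrightarrow> had3 (had3 \<phi>) x q = \<phi> x q"
proof -
  assume q: "q < 2"
  have "had3 (had3 \<phi>) x q = (\<Sum>v<2. (\<Sum>u<2. hadamard 1 u q * hadamard 1 u v) * \<phi> x v)"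
    unfolding had3_def sum_distrib_left sum_distrib_right
    by (subst sum.swap) (simp add: hadamard_commute mult.assoc)
  also have "\<dots> = (\<Sum>v<2. if v = q then \<phi> x v else 0)"
    using q hadamard_orthogonal[of q 1] by (intro sum.cong) auto
  finally show ?thesis using q by simp
qed

lemma had1_had1: "x < 2 ^ n \<Longrightarrow> had1 (had1 \<phi>) x q = \<phi> x q"
proof -
  assume x: "x < 2 ^ n"
  have "had1 (had1 \<phi>) x q = (\<Sum>v<2 ^ n. (\<Sum>u<2 ^ n. hadamard n u x * hadamard n u v) * \<phi> v q)"
    unfolding had1_def sum_distrib_left sum_distrib_right
    by (subst sum.swap) (simp add: hadamard_commute[of n x] mult.assoc)
  also have "\<dots> = (\<Sum>v<2 ^ n. if v = x then \<phi> v q else 0)"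
    using x hadamard_orthogonal[of x n] by (intro sum.cong) auto
  finally show ?thesis using x by simp
qed

lemma phase_square: "phase x * phase x = 1"
  by (simp add: mac_phase_def flip: power_add of_real_mult)

lemma cphase_cphase: "cphase (cphase \<phi>) = \<phi>"
  by (auto simp: cphase_def fun_eq_iff mult.assoc[symmetric] phase_square)

lemma had1_cong: "(\<And>x. x < 2 ^ n \<Longrightarrow> \<phi> x q = \<phi>' x q) \<Longrightarrow> had1 \<phi> x q = had1 \<phi>' x q"
  by (simp add: had1_def)

lemma had3_cong: "(\<And>q. q < 2 \<Longrightarrow> \<phi> x q = \<phi>' x q) \<Longrightarrow> had3 \<phi> x q = had3 \<phi>' x q"
  by (simp add: had3_def)

text \<open>The factors are involutions and \<open>test_adj\<close> applies them in reverse order.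
  The Hadamard factors cancel only at indices within range, so the inner cancellation is carried out
  pointwise under the outer sums.\<close>

lemma test_test_adj:
  assumes "x < 2 ^ n" "q < 2"
  shows "test (test_adj \<phi>) x q = \<phi> x q"
proof -
  have "had1 (had3 (had3 (had1 \<phi>'))) x q = \<phi>' x q" if "x < 2 ^ n" "q < 2" for \<phi>' x q
    using had1_cong[of "had3 (had3 (had1 \<phi>'))" q "had1 \<phi>'" x] that by (simp add: had3_had3 had1_had1)
  then have "cphase (had1 (had3 (had3 (had1 (cphase (had3 \<phi>)))))) x q = cphase (cphase (had3 \<phi>)) x q" if "q < 2" for q
    using assms that by (simp add: cphase_def)
  then have "test (test_adj \<phi>) x q = had3 (had3 \<phi>) x q"
    unfolding test_def test_adj_def by (intro had3_cong) (simp add: cphase_cphase)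
  then show ?thesis using assms by (simp add: had3_had3)
qed

text \<open>The combination has the shape of the reflection \<open>2 |0><0| - 1\<close> applied to a
  vector; in \<open>slice_grover\<close> the test is pulled through it.\<close>

lemma test_linear:
  "test (\<lambda>x q. c * \<phi> x q - \<phi>' x q) x q = c * test \<phi> x q - test \<phi>' x q"
  by (simp add: test_def had1_def had3_def cphase_def algebra_simps sum_subtractf sum_distrib_left)

text \<open>The state that the Hadamard test prepares from the zero state: the branches with and
  without the phase interfere to their sum at qubit 0 and their difference at qubit 1.\<close>

definition start :: "nat \<Rightarrow> nat \<Rightarrow> complex" where
  "start x q = (if q = 0 then 1 + phase x else 1 - phase x) / (2 * complex_of_real (sqrt (2 ^ n)))"

lemma sqrt2: "complex_of_real (sqrt 2) * complex_of_real (sqrt 2) = 2"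
  by (metis of_real_mult of_real_numeral real_sqrt_mult_self abs_numeral)

lemma dot_1: "dot 1 u v = of_bool (odd u \<and> odd v)"
  by (simp add: dot_def bit_0)

lemma had3_eq: "had3 \<phi> x q = (\<phi> x 0 + (- 1) ^ q * \<phi> x 1) / complex_of_real (sqrt 2)"
  by (cases "odd q")
    (simp_all add: had3_def hadamard_def lessThan_Suc eval_nat_numeral dot_1[simplified] add_divide_distrib diff_divide_distrib)

lemma test_init:
  assumes "x < 2 ^ n" "q < 2"
  shows "test (\<lambda>x q. if x = 0 \<and> q = 0 then 1 else 0) x q = start x q"
proof -
  let ?r = "complex_of_real (sqrt (2 ^ n))"
  have h: "had1 (had3 (\<lambda>x q. if x = 0 \<and> q = 0 then 1 else 0)) x q = 1 / (?r * complex_of_real (sqrt 2))" for x q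
  proof -
    have "had1 (had3 (\<lambda>x q. if x = 0 \<and> q = 0 then 1 else 0)) x q
        = (\<Sum>v<2 ^ n. if v = (0 :: nat) then 1 / (?r * complex_of_real (sqrt 2)) else 0)"
      unfolding had1_def by (intro sum.cong refl) (simp add: had3_eq hadamard_def)
    then show ?thesis by simp
  qed
  have "q = 0 \<or> q = 1" using assms by auto
  then show ?thesis
    unfolding test_def had3_eq[of "cphase _"] cphase_def h start_def
    by (auto simp: had3_eq add_divide_distrib diff_divide_distrib sqrt2 mult.assoc) (simp_all add: mult.commute)
qed

text \<open>With A the test, this is <0|A^{-1} phi> = <A 0|phi>; no conjugate appears because
  \<open>start\<close> is real.\<close>

lemma test_adj_zero:
  "test_adj \<phi> 0 0 = (\<Sum>x<2 ^ n. start x 0 * \<phi> x 0 + start x 1 * \<phi> x 1)"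
proof -
  let ?r = "complex_of_real (sqrt (2 ^ n))"
  have h: "had1 \<phi>' 0 q = (\<Sum>x<2 ^ n. \<phi>' x q) / ?r" for \<phi>' q
    by (simp add: had1_def hadamard_def sum_divide_distrib)
  show ?thesis
    unfolding test_adj_def had3_eq[of "had1 _"] h
    by (simp add: cphase_def had3_eq start_def sum_divide_distrib sum.distrib[symmetric] add_divide_distrib[symmetric])
      (intro sum.cong refl, simp add: field_simps sqrt2)
qed

text \<open>On slices the second diagonal gate is \<open>2 |0><0| - 1\<close>. Conjugated by the
  test it becomes \<open>2 |start><start| - 1\<close>, applied after the sign change at qubit 0.
  With the control off both diagonals are the identity and the test cancels against its
  adjoint.\<close>

lemma slice_grover:
  assumes "slice \<psi> \<phi>"
  shows "slice (run (grover n \<alpha> \<beta> k) \<psi>) (\<lambda>j x q. if k < j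
    then 2 * (\<Sum>x<2 ^ n. start x 1 * \<phi> j x 1 - start x 0 * \<phi> j x 0) * start x q
      - (if q = 0 then - \<phi> j x q else \<phi> j x q)
    else \<phi> j x q)"
proof -
  define \<phi>1 where "\<phi>1 = (\<lambda>j x q. (if k < j \<and> q = 0 then - 1 else 1) * \<phi> j x q)"
  define \<phi>2 where "\<phi>2 = (\<lambda>j. test_adj (\<phi>1 j))"
  define \<phi>3 where "\<phi>3 = (\<lambda>j x q. (if k < j \<and> \<not> (x = 0 \<and> q = 0) then - 1 else 1) * \<phi>2 j x q)"
  let ?D1 = "\<lambda>s. if k < s ! 4 \<and> s ! 3 = 0 then -1 else 1"
  let ?D3 = "\<lambda>s. if k < s ! 4 \<and> \<not> (s ! 1 = 0 \<and> s ! 2 = 0 \<and> s ! 3 = 0) then -1 else 1"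
  have 1: "slice (apply_gate dims n B (Diag ?D1) \<psi>) \<phi>1"
    by (rule slice_cong[OF slice_Diag[OF assms]]) (simp add: \<phi>1_def)
  have 2: "slice (run (adj (hadamard_test n \<alpha> \<beta>)) (apply_gate dims n B (Diag ?D1) \<psi>)) \<phi>2"
    unfolding \<phi>2_def by (rule slice_adj_hadamard_test[OF 1])
  have 3: "slice (apply_gate dims n B (Diag ?D3) (run (adj (hadamard_test n \<alpha> \<beta>)) (apply_gate dims n B (Diag ?D1) \<psi>))) \<phi>3"
    by (rule slice_cong[OF slice_Diag[OF 2]]) (simp add: \<phi>3_def)
  have 4: "slice (run (grover n \<alpha> \<beta> k) \<psi>) (\<lambda>j. test (\<phi>3 j))"
    using slice_hadamard_test[OF 3] by (simp add: grover_def del: apply_gate.simps)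
  show ?thesis
  proof (rule slice_cong[OF 4])
    fix j x q :: nat assume x: "x < 2 ^ n" "q < 2"
    show "test (\<phi>3 j) x q = (if k < j
    then 2 * (\<Sum>x<2 ^ n. start x 1 * \<phi> j x 1 - start x 0 * \<phi> j x 0) * start x q
      - (if q = 0 then - \<phi> j x q else \<phi> j x q)
    else \<phi> j x q)"
    proof (cases "k < j")
      case False
      then have "\<phi>3 j = test_adj (\<phi> j)" by (simp add: \<phi>3_def \<phi>2_def \<phi>1_def)
      then show ?thesis using False x by (simp add: test_test_adj)
    next
      case True
      define c where "c = 2 * \<phi>2 j 0 0"
      have "\<phi>3 j = (\<lambda>x q. c * (if x = 0 \<and> q = 0 then 1 else 0) - \<phi>2 j x q)"
        using True by (auto simp: \<phi>3_def c_def fun_eq_iff)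
      then have "test (\<phi>3 j) x q = c * start x q - test (\<phi>2 j) x q"
        using x by (simp only: test_linear test_init)
      also have "test (\<phi>2 j) x q = \<phi>1 j x q" unfolding \<phi>2_def using x by (rule test_test_adj)
      also have "c = 2 * (\<Sum>x<2 ^ n. start x 1 * \<phi> j x 1 - start x 0 * \<phi> j x 0)"
        using True by (simp add: c_def \<phi>2_def test_adj_zero \<phi>1_def)
      finally show ?thesis using True by (simp add: \<phi>1_def)
    qed
  qed
qed


section \<open>Rotation in the plane of the good and the bad part\<close>

lemma sum_phase: "(\<Sum>x<2 ^ n. mac_phase n B w \<alpha> \<beta> x) = 2 ^ n * Cor n B w (\<alpha>, \<beta>)"
  by (simp add: Cor_def Cw_def)

definition angle :: real where "angle = arcsin (sqrt ((1 + Cor n B w (\<alpha>, \<beta>)) / 2))"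

text \<open>The normalised parts of \<^const>\<open>start\<close> with the qubit 0 and 1, or 0 if that part vanishes.\<close>

definition good :: "nat \<Rightarrow> nat \<Rightarrow> complex" where
  "good x q = (if q = 0 then start x 0 / complex_of_real (sin angle) else 0)"

definition bad :: "nat \<Rightarrow> nat \<Rightarrow> complex" where
  "bad x q = (if q = 1 then start x 1 / complex_of_real (cos angle) else 0)"

lemma sin_angle: "(sin angle)\<^sup>2 = (1 + Cor n B w (\<alpha>, \<beta>)) / 2"
  and cos_angle: "(cos angle)\<^sup>2 = (1 - Cor n B w (\<alpha>, \<beta>)) / 2"
proof -
  have "\<bar>Cor n B w (\<alpha>, \<beta>)\<bar> \<le> 1" by (rule abs_Cor_le_1)
  then have "0 \<le> (1 + Cor n B w (\<alpha>, \<beta>)) / 2" "(1 + Cor n B w (\<alpha>, \<beta>)) / 2 \<le> 1" by auto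
  moreover from this have "sin angle = sqrt ((1 + Cor n B w (\<alpha>, \<beta>)) / 2)"
    unfolding angle_def by (intro sin_arcsin) (auto intro: order_trans[of _ 0])
  ultimately show s: "(sin angle)\<^sup>2 = (1 + Cor n B w (\<alpha>, \<beta>)) / 2" by simp
  show "(cos angle)\<^sup>2 = (1 - Cor n B w (\<alpha>, \<beta>)) / 2"
    unfolding cos_squared_eq s by (simp add: field_simps)
qed

text \<open>The phase squares to 1, so the square of \<open>1 + phase x\<close> is twice itself, and
  likewise for the difference. The sums are thus linear in the phase and yield the
  correlation.\<close>

lemma sum_start:
  "(\<Sum>x<2 ^ n. start x 0 * start x 0) = complex_of_real ((sin angle)\<^sup>2)"
  "(\<Sum>x<2 ^ n. start x 1 * start x 1) = complex_of_real ((cos angle)\<^sup>2)"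
proof -
  let ?r = "complex_of_real (sqrt (2 ^ n))"
  have rr: "?r * ?r = 2 ^ n"
    by (metis of_real_mult of_real_numeral of_real_power real_sqrt_mult_self abs_numeral power_abs)
  have S: "(\<Sum>x<2 ^ n. phase x) = 2 ^ n * complex_of_real (Cor n B w (\<alpha>, \<beta>))"
    using arg_cong[OF sum_phase, of complex_of_real] by simp
  have half: "(2 ^ n + 2 ^ n * c) / (2 * 2 ^ n) = (1 + c) / 2" for c :: complex
  proof -
    have "2 ^ n + 2 ^ n * c = 2 ^ n * (1 + c)" by (simp add: distrib_left)
    then show ?thesis by simp
  qed
  have "start x 0 * start x 0 = (1 + phase x) / (2 * 2 ^ n)" for x
    unfolding start_def rr[symmetric] by (simp add: algebra_simps phase_square add_divide_distrib)
  then have "(\<Sum>x<2 ^ n. start x 0 * start x 0) = (\<Sum>x<2 ^ n. 1 + phase x) / (2 * 2 ^ n)"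
    by (simp add: sum_divide_distrib)
  then show "(\<Sum>x<2 ^ n. start x 0 * start x 0) = complex_of_real ((sin angle)\<^sup>2)"
    by (simp add: sin_angle sum.distrib S half)
  have "start x 1 * start x 1 = (1 - phase x) / (2 * 2 ^ n)" for x
    unfolding start_def rr[symmetric] by (simp add: algebra_simps phase_square add_divide_distrib diff_divide_distrib)
  then have "(\<Sum>x<2 ^ n. start x 1 * start x 1) = (\<Sum>x<2 ^ n. 1 - phase x) / (2 * 2 ^ n)"
    by (simp add: sum_divide_distrib)
  then show "(\<Sum>x<2 ^ n. start x 1 * start x 1) = complex_of_real ((cos angle)\<^sup>2)"
    using half[of "- complex_of_real (Cor n B w (\<alpha>, \<beta>))"] by (simp add: cos_angle sum_subtractf S)
qed

lemma start_real: "cnj (start x q) = start x q"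
  by (simp add: start_def)

lemma sum_cmod_start:
  "(\<Sum>x<2 ^ n. (cmod (start x 0))\<^sup>2) = (sin angle)\<^sup>2"
  "(\<Sum>x<2 ^ n. (cmod (start x 1))\<^sup>2) = (cos angle)\<^sup>2"
proof -
  have "complex_of_real (\<Sum>x<2 ^ n. (cmod (start x q))\<^sup>2) = (\<Sum>x<2 ^ n. start x q * start x q)" for q
    by (simp add: complex_norm_square start_real del: of_real_power)
  from this[of 0, unfolded sum_start of_real_eq_iff] this[of 1, unfolded sum_start of_real_eq_iff]
  show "(\<Sum>x<2 ^ n. (cmod (start x 0))\<^sup>2) = (sin angle)\<^sup>2" "(\<Sum>x<2 ^ n. (cmod (start x 1))\<^sup>2) = (cos angle)\<^sup>2" .
qed

text \<open>If \<open>sin angle\<close> or \<open>cos angle\<close> is 0, the corresponding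
  normalised part is 0 by division by zero. The identity survives because that part of
  \<open>start\<close> has norm 0 and so vanishes pointwise.\<close>

lemma start_decomp:
  assumes "x < 2 ^ n" "q < 2"
  shows "start x q = complex_of_real (sin angle) * good x q + complex_of_real (cos angle) * bad x q"
proof -
  have "start x 0 = 0" if "sin angle = 0"
    using sum_cmod_start(1) assms that by (simp add: sum_nonneg_eq_0_iff)
  moreover have "start x 1 = 0" if "cos angle = 0"
    using sum_cmod_start(2) assms that by (simp add: sum_nonneg_eq_0_iff)
  moreover have "q = 0 \<or> q = 1" using assms by auto
  ultimately show ?thesis by (auto simp: good_def bad_def)
qed

lemma start_good: "(\<Sum>x<2 ^ n. start x 0 * good x 0) = complex_of_real (sin angle)"
  using sum_start(1) by (simp add: good_def sum_divide_distrib[symmetric] power2_eq_square)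

lemma start_bad: "(\<Sum>x<2 ^ n. start x 1 * bad x 1) = complex_of_real (cos angle)"
  using sum_start(2) by (simp add: bad_def sum_divide_distrib[symmetric] power2_eq_square)

lemma norm_good: "(\<Sum>x<2 ^ n. (cmod (good x 0))\<^sup>2) \<le> 1"
  using sum_cmod_start(1)
  by (simp add: good_def norm_divide power_divide sum_divide_distrib[symmetric] divide_le_eq_1)

lemma norm_bad: "(\<Sum>x<2 ^ n. (cmod (bad x 1))\<^sup>2) \<le> 1"
  using sum_cmod_start(2)
  by (simp add: bad_def norm_divide power_divide sum_divide_distrib[symmetric] divide_le_eq_1)

definition rotated :: "real \<Rightarrow> nat \<Rightarrow> nat \<Rightarrow> complex" where
  "rotated t x q = complex_of_real (sin t) * good x q + complex_of_real (cos t) * bad x q"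

text \<open>Negating the good part sends \<open>t\<close> to \<open>- t\<close>; the reflection in
  \<open>start\<close>, which sits at \<open>angle\<close>, sends \<open>- t\<close> to
  \<open>2 * angle + t\<close>.\<close>

lemma grover_rotates:
  assumes "x < 2 ^ n" "q < 2"
  shows "2 * (\<Sum>x<2 ^ n. start x 1 * rotated t x 1 - start x 0 * rotated t x 0) * start x q
      - (if q = 0 then - rotated t x q else rotated t x q) = rotated (t + 2 * angle) x q"
proof -
  let ?s = "complex_of_real (sin angle)" and ?c = "complex_of_real (cos angle)"
  let ?st = "complex_of_real (sin t)" and ?ct = "complex_of_real (cos t)"
  have "(\<Sum>x<2 ^ n. start x 1 * rotated t x 1 - start x 0 * rotated t x 0)
      = ?ct * (\<Sum>x<2 ^ n. start x 1 * bad x 1) - ?st * (\<Sum>x<2 ^ n. start x 0 * good x 0)"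
    unfolding sum_distrib_left sum_subtractf[symmetric]
    by (intro sum.cong refl) (simp add: rotated_def good_def bad_def mult_ac)
  also have "\<dots> = ?ct * ?c - ?st * ?s" by (simp only: start_good start_bad)
  finally have ip: "(\<Sum>x<2 ^ n. start x 1 * rotated t x 1 - start x 0 * rotated t x 0) = ?ct * ?c - ?st * ?s" .
  \<comment> \<open>Each coordinate uses the form of \<open>cos (2 * angle)\<close> that fits it, so
    that both identities become purely polynomial.\<close>
  have d: "sin (2 * angle) = 2 * sin angle * cos angle" "cos (2 * angle) = 1 - 2 * (sin angle)\<^sup>2"
    "cos (2 * angle) = 2 * (cos angle)\<^sup>2 - 1"
    by (rule sin_double cos_double_sin cos_double_cos)+
  have q: "q = 0 \<or> q = 1" using assms by auto
  show ?thesis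
  proof (cases "q = 0")
    case True
    have sc: "complex_of_real (sin (t + 2 * angle)) = ?st * (1 - 2 * ?s\<^sup>2) + ?ct * (2 * ?s * ?c)"
      by (simp add: sin_add d(1,2))
    show ?thesis unfolding ip start_decomp[OF assms] unfolding rotated_def sc using True
      by (simp add: bad_def algebra_simps power2_eq_square)
  next
    case False
    have cc: "complex_of_real (cos (t + 2 * angle)) = ?ct * (2 * ?c\<^sup>2 - 1) - ?st * (2 * ?s * ?c)"
      by (simp add: cos_add d(1,3))
    show ?thesis unfolding ip start_decomp[OF assms] unfolding rotated_def cc using False q
      by (auto simp: good_def algebra_simps power2_eq_square)
  qed
qed

text \<open>Step \<open>k\<close> acts on the branches with \<open>k < j\<close>, so after
  \<open>m\<close> steps branch \<open>j\<close> has been rotated \<open>min j m\<close> times by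
  \<open>2 * angle\<close>, starting from \<open>angle\<close>.\<close>

lemma slice_grover_powers:
  assumes "slice \<psi> (\<lambda>j x q. c j * start x q)"
  shows "slice (run (concat (map (grover n \<alpha> \<beta>) [0..<m])) \<psi>)
    (\<lambda>j x q. c j * rotated (real (2 * min j m + 1) * angle) x q)"
proof (induction m)
  case 0
  show ?case using assms by (auto simp: slice_def rotated_def start_decomp)
next
  case (Suc m)
  have "slice (run (grover n \<alpha> \<beta> m) (run (concat (map (grover n \<alpha> \<beta>) [0..<m])) \<psi>))
    (\<lambda>j x q. c j * rotated (real (2 * min j (Suc m) + 1) * angle) x q)"
  proof (rule slice_cong[OF slice_grover[OF Suc]])
    fix j x q :: nat assume x: "x < 2 ^ n" "q < 2"
    let ?t = "real (2 * min j m + 1) * angle"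
    show "(if m < j
    then 2 * (\<Sum>x<2 ^ n. start x 1 * (c j * rotated ?t x 1) - start x 0 * (c j * rotated ?t x 0)) * start x q
      - (if q = 0 then - (c j * rotated ?t x q) else c j * rotated ?t x q)
    else c j * rotated ?t x q) = c j * rotated (real (2 * min j (Suc m) + 1) * angle) x q"
    proof (cases "m < j")
      case True
      have "2 * (\<Sum>x<2 ^ n. start x 1 * (c j * rotated ?t x 1) - start x 0 * (c j * rotated ?t x 0)) * start x q
        - (if q = 0 then - (c j * rotated ?t x q) else c j * rotated ?t x q)
        = c j * (2 * (\<Sum>x<2 ^ n. start x 1 * rotated ?t x 1 - start x 0 * rotated ?t x 0) * start x q
        - (if q = 0 then - rotated ?t x q else rotated ?t x q))"
        by (auto simp: sum_distrib_left algebra_simps)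
      also have "\<dots> = c j * rotated (?t + 2 * angle) x q" by (simp only: grover_rotates[OF x])
      also have "?t + 2 * angle = real (2 * min j (Suc m) + 1) * angle" using True by (simp add: algebra_simps)
      finally show ?thesis using True by simp
    next
      case False
      then show ?thesis by (simp add: min_def)
    qed
  qed
  then show ?case by simp
qed

section \<open>The law of the counter outcome\<close>

text \<open>Taken at the sine it is the coefficient of the good part at counter outcome
  \<open>y\<close>, at the cosine that of the bad part.\<close>

definition counter_amplitude :: "nat \<Rightarrow> (real \<Rightarrow> real) \<Rightarrow> complex" where
  "counter_amplitude y f = (\<Sum>j<M. cnj (fourier M j y) * (fourier M j 0 * complex_of_real (f (real (2 * j + 1) * angle))))"

lemma slice_amplitude_estimation:
  "slice (run_circuit dims n B (amplitude_estimation n \<alpha> \<beta> M) [w, 0, 0, 0, 0])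
    (\<lambda>y x q. counter_amplitude y sin * good x q + counter_amplitude y cos * bad x q)"
proof -
  let ?\<psi>0 = "\<lambda>s. if s = [w, 0, 0, 0, 0] then 1 else 0"
  let ?\<psi>1 = "run (hadamard_test n \<alpha> \<beta>) ?\<psi>0"
  let ?\<psi>2 = "apply_gate dims n B (Local 4 (fourier M)) ?\<psi>1"
  let ?\<psi>3 = "run (concat (map (grover n \<alpha> \<beta>) [0..<M - 1])) ?\<psi>2"
  have "slice ?\<psi>0 (\<lambda>j x q. if j = 0 \<and> x = 0 \<and> q = 0 then 1 else 0)"
    by (auto simp: slice_def)
  then have "slice ?\<psi>1 (\<lambda>j. test (\<lambda>x q. if j = 0 \<and> x = 0 \<and> q = 0 then 1 else 0))"
    by (rule slice_hadamard_test)
  then have "slice ?\<psi>1 (\<lambda>j x q. if j = 0 then start x q else 0)"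
  proof (rule slice_cong)
    fix j x q :: nat assume x: "x < 2 ^ n" "q < 2"
    have "test (\<lambda>x q. 0) x q = 0" by (simp add: test_def had1_def had3_def cphase_def)
    then show "test (\<lambda>x q. if j = 0 \<and> x = 0 \<and> q = 0 then 1 else 0) x q = (if j = 0 then start x q else 0)"
      using test_init[OF x] by (cases "j = 0") simp_all
  qed
  then have 2: "slice ?\<psi>2 (\<lambda>j x q. \<Sum>v<M. fourier M j v * (if v = 0 then start x q else 0))"
    by (rule slice_Local4)
  have "slice ?\<psi>2 (\<lambda>j x q. fourier M j 0 * start x q)"
  proof (rule slice_cong[OF 2])
    fix j x q
    have "(\<Sum>v<M. fourier M j v * (if v = 0 then start x q else 0)) = (\<Sum>v<M. if v = 0 then fourier M j 0 * start x q else 0)"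
      by (intro sum.cong) auto
    then show "(\<Sum>v<M. fourier M j v * (if v = 0 then start x q else 0)) = fourier M j 0 * start x q"
      using M by simp
  qed
  then have "slice ?\<psi>3 (\<lambda>j x q. fourier M j 0 * rotated (real (2 * min j (M - 1) + 1) * angle) x q)"
    by (rule slice_grover_powers)
  then have "slice (apply_gate dims n B (Local 4 (\<lambda>u v. cnj (fourier M v u))) ?\<psi>3)
      (\<lambda>y x q. \<Sum>j<M. cnj (fourier M j y) * (fourier M j 0 * rotated (real (2 * min j (M - 1) + 1) * angle) x q))"
    by (rule slice_Local4)
  moreover have "run_circuit dims n B (amplitude_estimation n \<alpha> \<beta> M) [w, 0, 0, 0, 0]
      = apply_gate dims n B (Local 4 (\<lambda>u v. cnj (fourier M v u))) ?\<psi>3"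
    by (simp add: run_circuit_def amplitude_estimation_def adj_def)
  ultimately have 4: "slice (run_circuit dims n B (amplitude_estimation n \<alpha> \<beta> M) [w, 0, 0, 0, 0])
      (\<lambda>y x q. \<Sum>j<M. cnj (fourier M j y) * (fourier M j 0 * rotated (real (2 * min j (M - 1) + 1) * angle) x q))"
    by (simp only:)
  show ?thesis
  proof (rule slice_cong[OF 4])
    fix y x q
    \<comment> \<open>Counter values stay below \<open>M\<close>, so the cap at \<open>M - 1\<close>
      is never active and \<open>M - 1\<close> controlled steps suffice.\<close>
    have "(\<Sum>j<M. cnj (fourier M j y) * (fourier M j 0 * rotated (real (2 * min j (M - 1) + 1) * angle) x q))
        = (\<Sum>j<M. cnj (fourier M j y) * (fourier M j 0 * rotated (real (2 * j + 1) * angle) x q))"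
      by (intro sum.cong refl) (simp add: min_absorb1)
    also have "\<dots> = counter_amplitude y sin * good x q + counter_amplitude y cos * bad x q"
      unfolding counter_amplitude_def rotated_def sum_distrib_right sum.distrib[symmetric]
      by (intro sum.cong refl) (simp add: algebra_simps)
    finally show "(\<Sum>j<M. cnj (fourier M j y) * (fourier M j 0 * rotated (real (2 * min j (M - 1) + 1) * angle) x q))
        = counter_amplitude y sin * good x q + counter_amplitude y cos * bad x q" .
  qed
qed

text \<open>Adding or subtracting \<open>\<i>\<close> times the sine amplitude merges sine and
  cosine into a single exponential of plus or minus \<open>angle\<close>, so the Fourier sum becomes
  geometric; the sign is the parameter \<open>s\<close> of the proof.\<close>

lemma cmod_counter_amplitude:
  "(cmod (counter_amplitude y sin))\<^sup>2 + (cmod (counter_amplitude y cos))\<^sup>2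
   = ((cmod (\<Sum>j<M. cis (2 * (angle - pi * real y / real M)) ^ j) / real M)\<^sup>2
      + (cmod (\<Sum>j<M. cis (2 * (- angle - pi * real y / real M)) ^ j) / real M)\<^sup>2) / 2"
proof -
  let ?S = "counter_amplitude y sin" and ?C = "counter_amplitude y cos"
  have sq: "complex_of_real (sqrt (real M)) * complex_of_real (sqrt (real M)) = of_nat M"
    by (metis of_real_mult of_real_of_nat_eq real_sqrt_mult_self abs_of_nat)
  have f: "cnj (fourier M j y) * fourier M j 0 = cis (- 2 * pi * real j * real y / real M) / of_nat M" for j
    by (simp add: fourier_def cis_cnj sq)
  have e: "?C + \<i> * (complex_of_real s * ?S) = cis (s * angle) * (\<Sum>j<M. cis (2 * (s * angle - pi * real y / real M)) ^ j) / of_nat M"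
    if s: "s = 1 \<or> s = - 1" for s
  proof -
    let ?F = "\<lambda>j. cis (- 2 * pi * real j * real y / real M) / of_nat M"
    let ?t = "\<lambda>j. real (2 * j + 1) * angle"
    have amp: "counter_amplitude y h = (\<Sum>j<M. ?F j * complex_of_real (h (?t j)))" for h
      unfolding counter_amplitude_def mult.assoc[symmetric] f ..
    have c: "complex_of_real (cos (?t j)) + \<i> * (complex_of_real s * complex_of_real (sin (?t j)))
        = cis (real (2 * j + 1) * (s * angle))" for j
    proof -
      have "complex_of_real (cos t) + \<i> * (complex_of_real s * complex_of_real (sin t)) = cis (s * t)" for t
        using s by (auto simp: complex_eq_iff)
      then show ?thesis by (simp only: mult.left_commute[of s])
    qed
    have "?C + \<i> * (complex_of_real s * ?S)
        = (\<Sum>j<M. ?F j * (complex_of_real (cos (?t j)) + \<i> * (complex_of_real s * complex_of_real (sin (?t j)))))"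
      unfolding amp sum_distrib_left distrib_left sum.distrib
      by (intro arg_cong2[where f = "(+)"] sum.cong refl) (simp only: mult_ac)
    also have "\<dots> = (\<Sum>j<M. ?F j * cis (real (2 * j + 1) * (s * angle)))" by (simp only: c)
    also have "\<dots> = cis (s * angle) * (\<Sum>j<M. cis (2 * (s * angle - pi * real y / real M)) ^ j) / of_nat M"
      unfolding sum_distrib_left sum_divide_distrib
      by (intro sum.cong refl) (simp add: Complex.DeMoivre cis_mult algebra_simps)
    finally show ?thesis .
  qed
  have "(cmod (?C + \<i> * ?S))\<^sup>2 + (cmod (?C - \<i> * ?S))\<^sup>2 = 2 * ((cmod ?S)\<^sup>2 + (cmod ?C)\<^sup>2)"
    unfolding cmod_power2 by (simp add: power2_eq_square algebra_simps)
  moreover have "cmod (?C + \<i> * ?S) = cmod (\<Sum>j<M. cis (2 * (angle - pi * real y / real M)) ^ j) / real M"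
    using arg_cong[OF e[of 1], of cmod] by (simp add: norm_mult norm_divide)
  moreover have "cmod (?C - \<i> * ?S) = cmod (\<Sum>j<M. cis (2 * (- angle - pi * real y / real M)) ^ j) / real M"
    using arg_cong[OF e[of "- 1"], of cmod] by (simp add: norm_mult norm_divide)
  ultimately show ?thesis by simp
qed

lemma valid_amplitude_estimation: "list_all (valid_gate dims n) (amplitude_estimation n \<alpha> \<beta> M)"
proof -
  have H: "unitary_matrix 2 (hadamard 1)" "unitary_matrix 2 (hadamard (Suc 0))"
    using unitary_matrix_hadamard[of 1] by simp_all
  have cp: "list_all (valid_gate dims n) (controlled_phase n \<alpha> \<beta>)"
    by (simp add: controlled_phase_def norm_power)
  have ht: "list_all (valid_gate dims n) (hadamard_test n \<alpha> \<beta>)"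
    "list_all (valid_gate dims n) (adj (hadamard_test n \<alpha> \<beta>))"
    unfolding adj_hadamard_test unfolding hadamard_test_def
    using cp H by (simp_all add: unitary_matrix_hadamard)
  have "list_all (valid_gate dims n) (grover n \<alpha> \<beta> k)" for k
    using ht by (simp add: grover_def)
  then have "list_all (valid_gate dims n) (concat (map (grover n \<alpha> \<beta>) ks))" for ks
    by (induction ks) auto
  moreover have "list_all (valid_gate dims n) (adj [Local 4 (fourier M)])"
    by (simp add: adj_def unitary_matrix_fourier)
  ultimately show ?thesis
    using ht by (simp add: amplitude_estimation_def unitary_matrix_fourier)
qed

lemma sin_squared_diff: "(sin x)\<^sup>2 - (sin y)\<^sup>2 = sin (x + y) * sin (x - y)" for x y :: real
proof -
  have "sin (x + y) * sin (x - y) = (sin x)\<^sup>2 * (cos y)\<^sup>2 - (cos x)\<^sup>2 * (sin y)\<^sup>2"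
    by (simp add: sin_add sin_diff power2_eq_square algebra_simps)
  then show ?thesis unfolding cos_squared_eq by (simp add: algebra_simps)
qed

lemma counter_far:
  assumes far: "\<bar>(sin (pi * real y / real M))\<^sup>2 - (sin angle)\<^sup>2\<bar> > 16 / real M"
  defines "u \<equiv> sin (angle - pi * real y / real M)" and "v \<equiv> sin (- angle - pi * real y / real M)"
  shows "(cmod (counter_amplitude y sin))\<^sup>2 + (cmod (counter_amplitude y cos))\<^sup>2
    \<le> ((if \<bar>u\<bar> > 16 / real M then 1 / (real M * u)\<^sup>2 else 0) + (if \<bar>v\<bar> > 16 / real M then 1 / (real M * v)\<^sup>2 else 0)) / 2"
proof -
  have "(sin (pi * real y / real M))\<^sup>2 - (sin angle)\<^sup>2 = u * v"
  proof -
    have "u = - sin (pi * real y / real M - angle)" "v = - sin (pi * real y / real M + angle)"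
      unfolding u_def v_def sin_minus[symmetric] by (rule arg_cong[where f = sin], simp)+
    then show ?thesis by (simp add: sin_squared_diff)
  qed
  then have uv: "16 / real M < \<bar>u\<bar> * \<bar>v\<bar>" using far by (simp add: abs_mult)
  \<comment> \<open>A product of two numbers of modulus at most 1 is bounded by either factor, so
    each factor alone passes the threshold.\<close>
  have "\<bar>u\<bar> \<le> 1" "\<bar>v\<bar> \<le> 1" by (simp_all add: u_def v_def)
  then have "\<bar>u\<bar> * \<bar>v\<bar> \<le> \<bar>u\<bar> * 1" "\<bar>u\<bar> * \<bar>v\<bar> \<le> 1 * \<bar>v\<bar>"
    by (intro mult_left_mono mult_right_mono; simp)+
  with uv have b: "16 / real M < \<bar>u\<bar>" "16 / real M < \<bar>v\<bar>" by linarith+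
  moreover have "0 \<le> 16 / real M" by simp
  ultimately have "u \<noteq> 0" "v \<noteq> 0" by auto
  then show ?thesis
    unfolding cmod_counter_amplitude
    using geometric_cis_le[of "angle - pi * real y / real M" M] geometric_cis_le[of "- angle - pi * real y / real M" M] b
    by (simp add: u_def v_def)
qed

text \<open>The good and bad parts live on different qubit values and have norm at most 1, so
  summing out registers 1 and 3 leaves no cross terms and at most the two squared counter
  amplitudes.\<close>

lemma prob_amplitude_estimation:
  "measure (measured dims (run_circuit dims n B (amplitude_estimation n \<alpha> \<beta> M) [w, 0, 0, 0, 0]))
    {s. \<bar>(sin (pi * real (s ! 4) / real M))\<^sup>2 - (sin angle)\<^sup>2\<bar> > 16 / real M} \<le> 1 / 8"
proof -
  define \<psi> where "\<psi> = run_circuit dims n B (amplitude_estimation n \<alpha> \<beta> M) [w, 0, 0, 0, 0]"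
  let ?\<mu> = "measured dims \<psi>"
  let ?S = "\<lambda>y. counter_amplitude y sin" and ?C = "\<lambda>y. counter_amplitude y cos"
  define far where "far y \<longleftrightarrow> \<bar>(sin (pi * real y / real M))\<^sup>2 - (sin angle)\<^sup>2\<bar> > 16 / real M" for y
  let ?Y = "{y \<in> {..<M}. far y}"
  define f where "f = (\<lambda>(y, x, q). [w, x, 0, q, y :: nat])"
  have s0: "[w, 0, 0, 0, 0] \<in> basis dims" using w M by (auto simp: basis_def less_Suc_eq)
  have pmf: "pmf ?\<mu> s = (if s \<in> basis dims then (cmod (\<psi> s))\<^sup>2 else 0)" for s
    unfolding \<psi>_def by (rule pmf_measured[OF norm_run_circuit[OF B valid_amplitude_estimation s0]])
  have slice: "slice \<psi> (\<lambda>y x q. ?S y * good x q + ?C y * bad x q)"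
    unfolding \<psi>_def by (rule slice_amplitude_estimation)
  have basis: "s \<in> basis dims \<longleftrightarrow> (\<exists>a x z q y. s = [a, x, z, q, y] \<and> a < 2 ^ n \<and> x < 2 ^ n \<and> z < 2 ^ n \<and> q < 2 \<and> y < M)" for s
    by (auto simp: basis_def less_Suc_eq length_Suc_conv eval_nat_numeral)
  have sub: "{s. far (s ! 4)} \<inter> set_pmf ?\<mu> \<subseteq> f ` (?Y \<times> {..<2 ^ n} \<times> {..<2})"
  proof
    fix s assume s: "s \<in> {s. far (s ! 4)} \<inter> set_pmf ?\<mu>"
    then have "s \<in> basis dims" "\<psi> s \<noteq> 0" by (auto simp: set_pmf_eq pmf split: if_splits)
    then obtain a x z q y where e: "s = [a, x, z, q, y]" "a < 2 ^ n" "x < 2 ^ n" "z < 2 ^ n" "q < 2" "y < M"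
      by (auto simp: basis)
    with \<open>\<psi> s \<noteq> 0\<close> slice have "a = w" "z = 0" by (auto simp: slice_def split: if_splits)
    with e s show "s \<in> f ` (?Y \<times> {..<2 ^ n} \<times> {..<2})"
      by (auto simp: f_def intro!: image_eqI[of _ _ "(y, x, q)"])
  qed
  have "measure ?\<mu> {s. far (s ! 4)} = measure ?\<mu> ({s. far (s ! 4)} \<inter> set_pmf ?\<mu>)"
    by (simp add: measure_Int_set_pmf)
  also have "\<dots> \<le> measure ?\<mu> (f ` (?Y \<times> {..<2 ^ n} \<times> {..<2}))"
    using sub by (intro measure_pmf.finite_measure_mono) auto
  also have "\<dots> = (\<Sum>s\<in>f ` (?Y \<times> {..<2 ^ n} \<times> {..<2}). pmf ?\<mu> s)"
    by (intro measure_measure_pmf_finite) auto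
  also have "\<dots> = (\<Sum>t\<in>?Y \<times> {..<2 ^ n} \<times> {..<2}. pmf ?\<mu> (f t))"
    by (subst sum.reindex) (auto simp: inj_on_def f_def)
  also have "\<dots> = (\<Sum>y\<in>?Y. \<Sum>x<2 ^ n. \<Sum>q<2. pmf ?\<mu> [w, x, 0, q, y])"
    by (simp add: sum.cartesian_product f_def case_prod_unfold)
  also have "\<dots> = (\<Sum>y\<in>?Y. \<Sum>x<2 ^ n. (cmod (?S y))\<^sup>2 * (cmod (good x 0))\<^sup>2 + (cmod (?C y))\<^sup>2 * (cmod (bad x 1))\<^sup>2)"
  proof (intro sum.cong refl)
    fix y x :: nat assume y: "y \<in> ?Y" and x: "x \<in> {..<2 ^ n}"
    have p: "pmf ?\<mu> [w, x, 0, q, y] = (cmod (?S y * good x q + ?C y * bad x q))\<^sup>2" if "q < 2" for q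
      using y x that w slice by (auto simp: pmf basis slice_def)
    have two: "(\<Sum>q<2. h q) = h 0 + h 1" for h :: "nat \<Rightarrow> real" by (simp add: numeral_2_eq_2)
    have "good x 1 = 0" "bad x 0 = 0" by (simp_all add: good_def bad_def)
    then show "(\<Sum>q<2. pmf ?\<mu> [w, x, 0, q, y]) = (cmod (?S y))\<^sup>2 * (cmod (good x 0))\<^sup>2 + (cmod (?C y))\<^sup>2 * (cmod (bad x 1))\<^sup>2"
      using p[of 0] p[of 1] unfolding two by (simp add: norm_mult power_mult_distrib)
  qed
  also have "\<dots> \<le> (\<Sum>y\<in>?Y. (cmod (?S y))\<^sup>2 + (cmod (?C y))\<^sup>2)"
  proof (intro sum_mono)
    fix y
    have "(cmod (?S y))\<^sup>2 * (\<Sum>x<2 ^ n. (cmod (good x 0))\<^sup>2) \<le> (cmod (?S y))\<^sup>2 * 1"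
      "(cmod (?C y))\<^sup>2 * (\<Sum>x<2 ^ n. (cmod (bad x 1))\<^sup>2) \<le> (cmod (?C y))\<^sup>2 * 1"
      by (intro mult_left_mono norm_good norm_bad; simp)+
    then show "(\<Sum>x<2 ^ n. (cmod (?S y))\<^sup>2 * (cmod (good x 0))\<^sup>2 + (cmod (?C y))\<^sup>2 * (cmod (bad x 1))\<^sup>2)
        \<le> (cmod (?S y))\<^sup>2 + (cmod (?C y))\<^sup>2"
      by (simp add: sum.distrib sum_distrib_left)
  qed
  also have "\<dots> \<le> (\<Sum>y\<in>?Y. ((if \<bar>sin (angle - pi * real y / real M)\<bar> > 16 / real M then 1 / (real M * sin (angle - pi * real y / real M))\<^sup>2 else 0)
     + (if \<bar>sin (- angle - pi * real y / real M)\<bar> > 16 / real M then 1 / (real M * sin (- angle - pi * real y / real M))\<^sup>2 else 0)) / 2)"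
    by (intro sum_mono counter_far) (simp add: far_def)
  \<comment> \<open>The conditionals keep the terms nonnegative and restricted to far points, so the
    sum may run over all outcomes, as \<open>sum_far_le\<close> requires.\<close>
  also have "\<dots> \<le> (\<Sum>y<M. ((if \<bar>sin (angle - pi * real y / real M)\<bar> > 16 / real M then 1 / (real M * sin (angle - pi * real y / real M))\<^sup>2 else 0)
     + (if \<bar>sin (- angle - pi * real y / real M)\<bar> > 16 / real M then 1 / (real M * sin (- angle - pi * real y / real M))\<^sup>2 else 0)) / 2)"
    by (intro sum_mono2) auto
  also have "\<dots> \<le> 1 / 8"
    unfolding sum_divide_distrib[symmetric] sum.distrib
    by (rule order_trans[OF divide_right_mono[OF add_mono[OF sum_far_le[OF M] sum_far_le[OF M]]]]) auto
  finally show ?thesis by (simp add: \<psi>_def far_def)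
qed

text \<open>A test makes 4 queries, two of them to the adjoint for uncomputation. A Grover step
  contains the test and its adjoint, hence 8; the total is \<open>4 + 8 * (M - 1)\<close>.\<close>

lemma queries_amplitude_estimation:
  "circuit_queries (amplitude_estimation n \<alpha> \<beta> M) \<le> 8 * M"
proof -
  have cq: "circuit_queries (c @ d) = circuit_queries c + circuit_queries d" for c d
    by (simp add: circuit_queries_def)
  have ht: "circuit_queries (hadamard_test n \<alpha> \<beta>) = 4" "circuit_queries (adj (hadamard_test n \<alpha> \<beta>)) = 4"
    by (simp_all add: adj_hadamard_test) (simp_all add: hadamard_test_def controlled_phase_def circuit_queries_def)
  have g: "circuit_queries (grover n \<alpha> \<beta> k) = 8" for k
    unfolding grover_def cq ht by (simp add: circuit_queries_def)
  have "circuit_queries (concat (map (grover n \<alpha> \<beta>) ks)) = 8 * length ks" for ks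
    by (induction ks) (simp_all add: cq g, simp add: circuit_queries_def)
  then have "circuit_queries (amplitude_estimation n \<alpha> \<beta> M) = 4 + 8 * (M - 1)"
    unfolding amplitude_estimation_def cq ht by (simp add: circuit_queries_def adj_def)
  then show ?thesis using M by simp
qed

end

section \<open>Accuracy and query count of quantum verification\<close>

text \<open>The error \<open>16 / M\<close> in \<open>(1 + Cor) / 2\<close> doubles in
  \<open>Cor\<close>, and \<open>M\<close> is chosen so that \<open>32 / M\<close> is at most
  \<open>\<epsilon>\<close>. The tail bound even gives probability 7/8.\<close>

lemma quantum_estimate_accurate:
  assumes B: "bij_betw B {..<2 ^ n} {..<2 ^ n}" and w: "w < 2 ^ n" and \<epsilon>: "\<epsilon> > 0"
  shows "measure (quantum_estimate n B w (\<alpha>, \<beta>) \<epsilon>) {(e, q). \<bar>e - Cor n B w (\<alpha>, \<beta>)\<bar> \<le> \<epsilon>} \<ge> 2 / 3"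
proof -
  define M where "M = nat \<lceil>32 / \<epsilon>\<rceil>"
  have M0: "M > 0" using \<epsilon> by (simp add: M_def)
  interpret amplitude_test n M B w \<alpha> \<beta> by unfold_locales (use B w M0 in auto)
  define \<mu> where "\<mu> = measured dims (run_circuit dims n B (amplitude_estimation n \<alpha> \<beta> M) [w, 0, 0, 0, 0])"
  have "32 / \<epsilon> \<le> real M" unfolding M_def by linarith
  then have M32: "32 / real M \<le> \<epsilon>" using \<epsilon> M0 by (simp add: field_simps)
  let ?far = "{s. \<bar>(sin (pi * real (s ! 4) / real M))\<^sup>2 - (sin angle)\<^sup>2\<bar> > 16 / real M}"
  have "1 - 1 / 8 \<le> measure \<mu> (- ?far)"
    using prob_amplitude_estimation measure_pmf.prob_compl[of ?far \<mu>] by (simp add: \<mu>_def Compl_eq_Diff_UNIV)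
  also have "\<dots> \<le> measure \<mu> {s. \<bar>2 * (sin (pi * real (s ! 4) / real M))\<^sup>2 - 1 - Cor n B w (\<alpha>, \<beta>)\<bar> \<le> \<epsilon>}"
  proof (rule measure_pmf.finite_measure_mono)
    show "- ?far \<subseteq> {s. \<bar>2 * (sin (pi * real (s ! 4) / real M))\<^sup>2 - 1 - Cor n B w (\<alpha>, \<beta>)\<bar> \<le> \<epsilon>}"
    proof
      fix s assume "s \<in> - ?far"
      then have "2 * \<bar>(sin (pi * real (s ! 4) / real M))\<^sup>2 - (sin angle)\<^sup>2\<bar> \<le> 32 / real M" by simp
      moreover have eq: "2 * (sin (pi * real (s ! 4) / real M))\<^sup>2 - 1 - Cor n B w (\<alpha>, \<beta>)
          = 2 * ((sin (pi * real (s ! 4) / real M))\<^sup>2 - (sin angle)\<^sup>2)"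
        unfolding sin_angle by (simp add: field_simps)
      ultimately show "s \<in> {s. \<bar>2 * (sin (pi * real (s ! 4) / real M))\<^sup>2 - 1 - Cor n B w (\<alpha>, \<beta>)\<bar> \<le> \<epsilon>}"
        using M32 unfolding mem_Collect_eq eq abs_mult by simp
    qed
  qed simp
  finally show ?thesis
    by (simp add: quantum_estimate_def Let_def M_def[symmetric] \<mu>_def[symmetric] vimage_def)
qed

text \<open>Rounding up costs at most \<open>1 / \<epsilon>\<close>, as \<open>\<epsilon>\<close> is
  at most 1, so \<open>M\<close> is at most \<open>33 / \<epsilon>\<close>; with 8 queries per unit
  of \<open>M\<close> this gives 264.\<close>

lemma quantum_estimate_queries:
  assumes B: "bij_betw B {..<2 ^ n} {..<2 ^ n}" and w: "w < 2 ^ n" and \<epsilon>: "0 < \<epsilon>" "\<epsilon> \<le> 1"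
    and eq: "(e, q) \<in> set_pmf (quantum_estimate n B w p \<epsilon>)"
  shows "real q \<le> 264 / \<epsilon>"
proof (cases p)
  case (Pair \<alpha> \<beta>)
  define M where "M = nat \<lceil>32 / \<epsilon>\<rceil>"
  have M0: "M > 0" using \<epsilon> by (simp add: M_def)
  interpret amplitude_test n M B w \<alpha> \<beta> by unfold_locales (use B w M0 in auto)
  have "0 \<le> 32 / \<epsilon>" using \<epsilon> by simp
  then have "real M \<le> 32 / \<epsilon> + 1" unfolding M_def by linarith
  moreover have "1 \<le> 1 / \<epsilon>" using \<epsilon> by simp
  ultimately have "8 * real M \<le> 264 / \<epsilon>" by (simp add: field_simps)
  moreover have "q = circuit_queries (amplitude_estimation n \<alpha> \<beta> M)"
    using eq unfolding Pair by (auto simp: quantum_estimate_def Let_def M_def)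
  then have "real q \<le> 8 * real M" using queries_amplitude_estimation by linarith
  ultimately show ?thesis by linarith
qed

section \<open>The distinguisher\<close>

text \<open>A sample is a sign, so its variance is at most 1; at least
  \<open>3 / \<epsilon>\<^sup>2\<close> samples bring the failure bound
  \<open>1 / (m * \<epsilon>\<^sup>2)\<close> down to 1/3.\<close>

lemma classical_estimate_accurate:
  assumes \<epsilon>: "\<epsilon> > 0"
  shows "measure (classical_estimate n B w (\<alpha>, \<beta>) \<epsilon>) {(e, q). \<bar>e - Cor n B w (\<alpha>, \<beta>)\<bar> \<le> \<epsilon>} \<ge> 2 / 3"
proof -
  define m where "m = nat \<lceil>3 / \<epsilon>\<^sup>2\<rceil>"
  define Q where "Q = classical_sample n B w (\<alpha>, \<beta>)"
  define c where "c = Cor n B w (\<alpha>, \<beta>)"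
  let ?h = "\<lambda>x. fst x - c"
  have "0 < 3 / \<epsilon>\<^sup>2" using \<epsilon> by simp
  then have m: "3 / \<epsilon>\<^sup>2 \<le> real m" "m > 0" unfolding m_def by linarith+
  have ne: "{..<2 ^ n :: nat} \<noteq> {}" by (simp add: lessThan_empty_iff)
  have Q: "Q = map_pmf (\<lambda>x. (mac_phase n B w \<alpha> \<beta> x, 2)) (pmf_of_set {..<2 ^ n})"
    by (simp add: Q_def classical_sample_def)
  have fin: "finite (set_pmf Q)" using ne by (simp add: Q)
  have EQ: "measure_pmf.expectation Q (\<lambda>x. F (fst x)) = (\<Sum>x<2 ^ n. F (mac_phase n B w \<alpha> \<beta> x)) / 2 ^ n" for F :: "real \<Rightarrow> real"
    using ne by (simp add: Q integral_pmf_of_set)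
  have h0: "measure_pmf.expectation Q ?h = 0"
    using EQ[of "\<lambda>x. x - c"] by (simp add: sum_subtractf diff_divide_distrib c_def Cor_eq_mean)
  have sq: "(mac_phase n B w \<alpha> \<beta> x)\<^sup>2 = 1" for x
    using abs_mac_phase[of n B w \<alpha> \<beta> x] by (metis power2_abs power_one)
  have "measure_pmf.expectation Q (\<lambda>x. (?h x)\<^sup>2) = (\<Sum>x<2 ^ n. (1 + c\<^sup>2) - 2 * c * mac_phase n B w \<alpha> \<beta> x) / 2 ^ n"
    by (subst EQ[of "\<lambda>x. (x - c)\<^sup>2"]) (simp add: power2_diff sq mult_ac)
  also have "\<dots> = 1 + c\<^sup>2 - 2 * c * ((\<Sum>x<2 ^ n. mac_phase n B w \<alpha> \<beta> x) / 2 ^ n)"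
    by (simp add: sum_subtractf diff_divide_distrib sum_distrib_left[symmetric])
  also have "\<dots> = 1 + c\<^sup>2 - 2 * c * c" by (simp only: c_def Cor_eq_mean)
  also have "\<dots> \<le> 1" by (simp add: power2_eq_square)
  finally have var: "measure_pmf.expectation Q (\<lambda>x. (?h x)\<^sup>2) \<le> 1" .
  let ?R = "replicate_pmf m Q"
  have fr: "finite (set_pmf ?R)"
    by (rule finite_subset[OF _ finite_lists_length_eq[OF fin, of m]]) (auto simp: set_replicate_pmf)
  let ?S = "\<lambda>xs. \<Sum>x\<leftarrow>xs. ?h x"
  have pos: "real m * \<epsilon> > 0" using m \<epsilon> by simp
  have "measure ?R {xs. \<bar>?S xs\<bar> \<ge> real m * \<epsilon>} \<le> measure_pmf.expectation ?R (\<lambda>xs. (?S xs)\<^sup>2) / (real m * \<epsilon>)\<^sup>2"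
    using measure_pmf.second_moment_method[of ?S ?R "real m * \<epsilon>"] pos fr
    by (simp add: integrable_measure_pmf_finite)
  also have "\<dots> \<le> real m / (real m * \<epsilon>)\<^sup>2"
    unfolding second_moment_replicate_pmf(1)[OF fin h0]
    using var by (intro divide_right_mono mult_left_le) auto
  also have "\<dots> = 1 / (real m * \<epsilon>\<^sup>2)" using m by (simp add: power2_eq_square)
  also have "\<dots> \<le> 1 / 3"
  proof -
    have "3 \<le> real m * \<epsilon>\<^sup>2" using m(1) \<epsilon> by (simp add: field_simps)
    then show ?thesis by simp
  qed
  finally have bad: "measure ?R {xs. \<bar>?S xs\<bar> \<ge> real m * \<epsilon>} \<le> 1 / 3" .
  have "2 / 3 \<le> measure ?R (- {xs. \<bar>?S xs\<bar> \<ge> real m * \<epsilon>})"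
    using bad measure_pmf.prob_compl[of "{xs. \<bar>?S xs\<bar> \<ge> real m * \<epsilon>}" ?R] by (simp add: Compl_eq_Diff_UNIV)
  \<comment> \<open>The centred sum is \<open>m\<close> times the error only for lists of length
    \<open>m\<close>, which the support guarantees.\<close>
  also have "\<dots> = measure ?R (- {xs. \<bar>?S xs\<bar> \<ge> real m * \<epsilon>} \<inter> set_pmf ?R)"
    by (simp add: measure_Int_set_pmf)
  also have "\<dots> \<le> measure ?R {xs. \<bar>sum_list (map fst xs) / real m - c\<bar> \<le> \<epsilon>}"
  proof (rule measure_pmf.finite_measure_mono)
    show "- {xs. \<bar>?S xs\<bar> \<ge> real m * \<epsilon>} \<inter> set_pmf ?R \<subseteq> {xs. \<bar>sum_list (map fst xs) / real m - c\<bar> \<le> \<epsilon>}"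
    proof
      fix xs assume xs: "xs \<in> - {xs. \<bar>?S xs\<bar> \<ge> real m * \<epsilon>} \<inter> set_pmf ?R"
      then have len: "length xs = m" by (simp add: set_replicate_pmf)
      have "?S xs = sum_list (map fst xs) - real (length xs) * c"
        by (induction xs) (auto simp: algebra_simps)
      then have "sum_list (map fst xs) / real m - c = ?S xs / real m"
        using m len by (simp add: field_simps)
      then show "xs \<in> {xs. \<bar>sum_list (map fst xs) / real m - c\<bar> \<le> \<epsilon>}"
        using xs m by (simp add: field_simps)
    qed
  qed simp
  finally show ?thesis
    by (simp add: classical_estimate_def Let_def m_def[symmetric] Q_def[symmetric] c_def[symmetric] vimage_def)
qed

lemma classical_estimate_queries:
  assumes \<epsilon>: "0 < \<epsilon>" "\<epsilon> \<le> 1" and eq: "(e, q) \<in> set_pmf (classical_estimate n B w p \<epsilon>)"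
  shows "real q \<le> 8 / \<epsilon>\<^sup>2"
proof -
  define m where "m = nat \<lceil>3 / \<epsilon>\<^sup>2\<rceil>"
  obtain \<alpha> \<beta> where p: "p = (\<alpha>, \<beta>)" by (cases p)
  have "0 \<le> 3 / \<epsilon>\<^sup>2" by simp
  then have "real m \<le> 3 / \<epsilon>\<^sup>2 + 1" unfolding m_def by linarith
  moreover have "1 \<le> 1 / \<epsilon>\<^sup>2" using \<epsilon> by (simp add: power_le_one)
  ultimately have "2 * real m \<le> 8 / \<epsilon>\<^sup>2" by (simp add: field_simps)
  moreover obtain xs where xs: "xs \<in> set_pmf (replicate_pmf m (classical_sample n B w p))" "q = sum_list (map snd xs)"
    using eq by (auto simp: classical_estimate_def Let_def m_def)
  have "\<forall>x\<in>set xs. snd x = 2" "length xs = m"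
    using xs(1) by (auto simp: set_replicate_pmf classical_sample_def p in_lists_conv_set)
  then have "q = 2 * m" unfolding xs(2) by (induction xs arbitrary: m) auto
  ultimately show ?thesis by simp
qed

section \<open>The law of a draw and of a run\<close>

lemma Cor_zero:
  assumes "bij_betw B {..<2 ^ n} {..<2 ^ n}" "w < 2 ^ n"
  shows "Cor n B w (0, 0) = 1"
  by (simp add: Cor_def Cw_zero[OF assms])

text \<open>A nonzero \<open>w\<close> forces \<open>n\<close> to be at least 1. For
  \<open>n = 0\<close> the only outcome would be \<open>(0, 0)\<close>, rejected forever under
  \<open>zero_pairs\<close>.\<close>

lemma mac_measure_rej:
  assumes B: "bij_betw B {..<2 ^ n} {..<2 ^ n}" and w: "w < 2 ^ n" "w \<noteq> 0" and rej: "rej \<in> {{}, zero_pairs}"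
  shows "measure (mac_measure n B w) rej \<le> 1 / 2"
proof -
  have "n \<noteq> 0" using w by (cases n) auto
  then have "(2 :: real) ^ 1 \<le> 2 ^ n" by (intro power_increasing) auto
  then show ?thesis using rej by (auto simp: mac_measure_zero_pairs[OF B w(1)])
qed

lemma draw_prob_eq:
  assumes "measure (mac_measure n B w) rej < 1"
  shows "draw_prob rej n B w \<tau>
    = measure (mac_measure n B w) ({p. (Cor n B w p)\<^sup>2 \<ge> \<tau>} - rej) / (1 - measure (mac_measure n B w) rej)"
proof -
  obtain P where P: "macsample rej n B w = spmf_of_pmf P"
    "P = bind_pmf (mac_measure n B w) (\<lambda>p. if p \<in> rej then map_pmf (\<lambda>(p', q). (p', 2 + q)) P else return_pmf (p, 2))"
    using macsample_pmf[OF assms] by blast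
  show ?thesis
    using rejection_measure[OF P(2) assms, of "{p. (Cor n B w p)\<^sup>2 \<ge> \<tau>}"]
    by (simp add: draw_prob_def P(1))
qed

lemma draw_prob_empty:
  assumes B: "bij_betw B {..<2 ^ n} {..<2 ^ n}" and w: "w < 2 ^ n"
  shows "draw_prob {} n B w \<tau> = adv n B w (2 ^ n * \<tau>)"
  by (simp add: draw_prob_eq measure_mac_measure_Cor[OF B w])

text \<open>Since \<open>\<tau>\<close> is at most 1, the pair \<open>(0, 0)\<close> of correlation
  1 belongs to the event; rejection therefore removes its mass \<open>1 / 2 ^ n\<close> from the
  event as well as from the total.\<close>

lemma draw_prob_zero_pairs:
  assumes B: "bij_betw B {..<2 ^ n} {..<2 ^ n}" and w: "w < 2 ^ n" "w \<noteq> 0" and \<tau>: "\<tau> \<le> 1"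
  shows "draw_prob zero_pairs n B w \<tau> = (adv n B w (2 ^ n * \<tau>) - 1 / 2 ^ n) / (1 - 1 / 2 ^ n)"
proof -
  let ?M = "mac_measure n B w" and ?E = "{p. (Cor n B w p)\<^sup>2 \<ge> \<tau>}"
  have Z: "measure ?M zero_pairs = 1 / 2 ^ n" "set_pmf ?M \<inter> zero_pairs = {(0, 0)}"
    by (rule mac_measure_zero_pairs[OF B w(1)])+
  have "(0, 0) \<in> ?E" using \<tau> by (simp add: Cor_zero[OF B w(1)])
  \<comment> \<open>The inclusion is needed only for zero pairs of positive probability, and
    \<open>(0, 0)\<close> is the only one.\<close>
  then have "set_pmf ?M \<inter> zero_pairs \<subseteq> ?E" unfolding Z(2) by blast
  then have "(?E \<inter> zero_pairs) \<inter> set_pmf ?M = zero_pairs \<inter> set_pmf ?M" by blast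
  then have EZ: "measure ?M (?E \<inter> zero_pairs) = 1 / 2 ^ n"
    using Z(1) measure_Int_set_pmf[of ?M "?E \<inter> zero_pairs"] measure_Int_set_pmf[of ?M zero_pairs] by simp
  have "measure ?M (?E - zero_pairs) = adv n B w (2 ^ n * \<tau>) - 1 / 2 ^ n"
    using measure_pmf.finite_measure_Diff'[of ?E ?M zero_pairs]
    by (simp only: EZ measure_mac_measure_Cor[OF B w(1)] sets_measure_pmf UNIV_I)
  moreover have "measure ?M zero_pairs < 1" using mac_measure_rej[OF B w, of zero_pairs] by simp
  ultimately show ?thesis by (simp add: draw_prob_eq Z(1))
qed

text \<open>Both verifications are treated at once: a verifier enters through its accuracy 2/3 at
  every pair and its query bound, for which 264 is large enough in both cases.\<close>

lemma fishing_run: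
  fixes verify :: verifier
  assumes B: "bij_betw B {..<2 ^ n} {..<2 ^ n}" and w: "w < 2 ^ n" "w \<noteq> 0" and rej: "rej \<in> {{}, zero_pairs}"
    and \<tau>: "\<tau> > 0"
    and acc: "\<And>\<alpha> \<beta>. measure (verify n B w (\<alpha>, \<beta>) (sqrt \<tau>)) {(e, q). \<bar>e - Cor n B w (\<alpha>, \<beta>)\<bar> \<le> sqrt \<tau>} \<ge> 2 / 3"
    and cost: "\<And>p e q. \<tau> \<le> 1 \<Longrightarrow> (e, q) \<in> set_pmf (verify n B w p (sqrt \<tau>)) \<Longrightarrow> real q \<le> 264 * cost"
    and cost1: "\<tau> \<le> 1 \<Longrightarrow> 1 \<le> cost"
  defines "a \<equiv> draw_prob rej n B w \<tau>" and "run \<equiv> fishing rej verify n B w \<tau>" and "c \<equiv> 20000 :: real"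
  shows "lossless_spmf run"
    and "measure (measure_spmf run) {r. success n B w \<tau> r} = a"
    and "(\<integral>\<^sup>+ r. ennreal (real (queries1 r)) \<partial>measure_spmf run) \<le> ennreal c"
    and "\<tau> \<le> 1 \<Longrightarrow> \<forall>r \<in> set_spmf run. real (queries2 r) \<le> c * cost"
    and "a > 0 \<Longrightarrow> \<exists>k. real k \<le> c / a \<and>
                (\<integral>\<^sup>+ rs. ennreal (real (total_queries rs)) \<partial>measure_spmf (repeat_spmf k run))
                  \<le> ennreal (c * cost / a) \<and>
                measure (measure_spmf (repeat_spmf k run))
                  {rs. real (total_queries rs) \<le> c * cost / a \<and>
                       (\<exists>r \<in> set rs. success n B w \<tau> r \<and> accurate n B w \<tau> r)}
                  \<ge> 2 / 3"
proof -
  let ?M = "mac_measure n B w"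
  have half: "measure ?M rej \<le> 1 / 2" by (rule mac_measure_rej[OF B w rej])
  then have lt: "measure ?M rej < 1" by simp
  obtain P where P: "macsample rej n B w = spmf_of_pmf P"
    "P = bind_pmf ?M (\<lambda>p. if p \<in> rej then map_pmf (\<lambda>(p', q). (p', 2 + q)) P else return_pmf (p, 2))"
    using macsample_pmf[OF lt] by blast
  define mk where "mk = (\<lambda>(p, q1) (e, q2). Run p e (if e\<^sup>2 \<ge> \<tau> then Cipher else RandomPermutation) q1 q2)"
  define R where "R = bind_pmf P (\<lambda>x. map_pmf (mk x) (verify n B w (fst x) (sqrt \<tau>)))"
  have run: "run = spmf_of_pmf R"
    unfolding run_def fishing_def P(1) R_def bind_spmf_of_pmf spmf_of_pmf_bind
    by (intro bind_pmf_cong refl) (auto simp: mk_def case_prod_unfold bind_pmf_return_spmf)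
  show "lossless_spmf run" by (simp add: run)
  have mk [simp]: "draw (mk x y) = fst x" "estimate (mk x y) = fst y" "queries1 (mk x y) = snd x" "queries2 (mk x y) = snd y" for x y
    by (simp_all add: mk_def case_prod_unfold)
  have a: "a = measure P {(p, q). (Cor n B w p)\<^sup>2 \<ge> \<tau>}"
    by (simp add: a_def draw_prob_def P(1))
  have "emeasure R {r. success n B w \<tau> r} = (\<integral>\<^sup>+ x. indicator {(p, q). (Cor n B w p)\<^sup>2 \<ge> \<tau>} x \<partial>P)"
    unfolding R_def emeasure_bind_pmf
    by (intro nn_integral_cong) (auto simp: success_def vimage_def indicator_def)
  then have "measure R {r. success n B w \<tau> r} = a"
    by (simp add: a measure_pmf.emeasure_eq_measure)
  then show "measure (measure_spmf run) {r. success n B w \<tau> r} = a" by (simp add: run)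
  have q1: "(\<integral>\<^sup>+ r. ennreal (real (queries1 r)) \<partial>R) \<le> ennreal 4"
    using rejection_cost[OF P(2) half] by (simp add: R_def)
  then show "(\<integral>\<^sup>+ r. ennreal (real (queries1 r)) \<partial>measure_spmf run) \<le> ennreal c"
    unfolding run c_def measure_spmf_spmf_of_pmf by (rule order_trans) (simp add: ennreal_leI)
  have q2: "real (queries2 r) \<le> 264 * cost" if "\<tau> \<le> 1" "r \<in> set_pmf R" for r
    using that(2) cost[OF that(1)] by (auto simp: R_def)
  show "\<forall>r \<in> set_spmf run. real (queries2 r) \<le> c * cost" if "\<tau> \<le> 1"
  proof
    fix r assume "r \<in> set_spmf run"
    then have "real (queries2 r) \<le> 264 * cost" using q2[OF that] by (simp add: run)
    also have "\<dots> \<le> c * cost" using cost1[OF that] by (simp add: c_def)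
    finally show "real (queries2 r) \<le> c * cost" .
  qed
  assume a0: "a > 0"
  \<comment> \<open>Correlations are at most 1 in modulus, so a positive chance of success excludes
    larger thresholds. This makes the query bounds available.\<close>
  have \<tau>1: "\<tau> \<le> 1"
  proof (rule ccontr)
    assume "\<not> \<tau> \<le> 1"
    moreover have "(Cor n B w p)\<^sup>2 \<le> 1" for p using abs_Cor_le_1[of n B w p] by (simp add: abs_square_le_1)
    ultimately have "{(p, q :: nat). (Cor n B w p)\<^sup>2 \<ge> \<tau>} = {}" by (auto dest: order_trans)
    then show False using a0 unfolding a by (simp only: measure_empty)
  qed
  have a1: "a \<le> 1" by (simp add: a)
  let ?G = "{r. success n B w \<tau> r \<and> accurate n B w \<tau> r}"
  have G: "measure R ?G \<ge> 2 / 3 * a"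
  proof -
    let ?E = "{(p, q :: nat). (Cor n B w p)\<^sup>2 \<ge> \<tau>}"
    have "ennreal (2 / 3 * a) = ennreal (2 / 3) * emeasure P ?E"
      unfolding a measure_pmf.emeasure_eq_measure by (rule ennreal_mult) auto
    also have "\<dots> = (\<integral>\<^sup>+ x. ennreal (2 / 3) * indicator ?E x \<partial>P)"
      by (simp add: nn_integral_cmult)
    also have "\<dots> \<le> (\<integral>\<^sup>+ x. emeasure (map_pmf (mk x) (verify n B w (fst x) (sqrt \<tau>))) ?G \<partial>P)"
    proof (intro nn_integral_mono)
      fix x
      show "ennreal (2 / 3) * indicator ?E x \<le> emeasure (map_pmf (mk x) (verify n B w (fst x) (sqrt \<tau>))) ?G"
      proof (cases "x \<in> ?E")
        case True
        obtain \<alpha> \<beta> q where x: "x = ((\<alpha>, \<beta>), q)" by (metis surj_pair)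
        have "mk x -` ?G = {(e, q). \<bar>e - Cor n B w (\<alpha>, \<beta>)\<bar> \<le> sqrt \<tau>}"
          using True by (auto simp: success_def accurate_def x)
        then show ?thesis using True acc[of \<alpha> \<beta>]
          by (simp add: x measure_pmf.emeasure_eq_measure ennreal_leI)
      qed simp
    qed
    also have "\<dots> = ennreal (measure R ?G)"
      by (simp add: R_def flip: measure_pmf.emeasure_eq_measure)
    finally show ?thesis by (simp add: ennreal_le_iff)
  qed
  let ?f = "\<lambda>r. queries1 r + queries2 r"
  \<comment> \<open>Phase 1 costs at most 4 queries in expectation, twice the 2 of one circuit;
    since \<open>cost\<close> is at least 1 they are absorbed into
    \<open>264 * cost\<close>.\<close>
  define m where "m = 268 * cost"
  have cost1': "1 \<le> cost" by (rule cost1[OF \<tau>1])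
  have f: "(\<integral>\<^sup>+ r. ennreal (real (?f r)) \<partial>R) \<le> ennreal m"
  proof -
    have "(\<integral>\<^sup>+ r. ennreal (real (?f r)) \<partial>R) = (\<integral>\<^sup>+ r. ennreal (real (queries1 r)) \<partial>R) + (\<integral>\<^sup>+ r. ennreal (real (queries2 r)) \<partial>R)"
      by (simp add: nn_integral_add)
    also have "(\<integral>\<^sup>+ r. ennreal (real (queries2 r)) \<partial>R) \<le> (\<integral>\<^sup>+ r. ennreal (264 * cost) \<partial>R)"
      using q2[OF \<tau>1] by (intro nn_integral_mono_AE) (auto simp: AE_measure_pmf_iff intro!: ennreal_leI)
    also have "(\<integral>\<^sup>+ r. ennreal (real (queries1 r)) \<partial>R) + \<dots> \<le> ennreal 4 + ennreal (264 * cost)"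
      using q1 by (intro add_mono) auto
    also have "\<dots> = ennreal (4 + 264 * cost)" using cost1' by (intro ennreal_plus[symmetric]) auto
    also have "\<dots> \<le> ennreal m" using cost1' by (intro ennreal_leI) (simp add: m_def)
    finally show ?thesis by (simp add: add_left_mono)
  qed
  \<comment> \<open>Here the value of \<open>c\<close> is decided: \<open>70 * 268\<close> is 18760,
    rounded up to 20000.\<close>
  have T: "70 * m / a \<le> c * cost / a" "0 < c * cost / a" "0 \<le> m" "7 / a * m \<le> c * cost / a"
    using a0 cost1' by (simp_all add: m_def c_def divide_right_mono)
  note amp = amplification[OF G a0 a1 f T(3) T(1,2)]
  have tot: "total_queries rs = (\<Sum>r\<leftarrow>rs. ?f r)" for rs by (simp add: total_queries_def)
  show "\<exists>k. real k \<le> c / a \<and>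
                (\<integral>\<^sup>+ rs. ennreal (real (total_queries rs)) \<partial>measure_spmf (repeat_spmf k run))
                  \<le> ennreal (c * cost / a) \<and>
                measure (measure_spmf (repeat_spmf k run))
                  {rs. real (total_queries rs) \<le> c * cost / a \<and>
                       (\<exists>r \<in> set rs. success n B w \<tau> r \<and> accurate n B w \<tau> r)}
                  \<ge> 2 / 3"
  proof (intro exI conjI)
    have "7 / a \<le> c / a" using a0 by (simp add: c_def divide_right_mono)
    then show "real (nat \<lceil>6 / a\<rceil>) \<le> c / a" using amp(1) by linarith
    show "(\<integral>\<^sup>+ rs. ennreal (real (total_queries rs)) \<partial>measure_spmf (repeat_spmf (nat \<lceil>6 / a\<rceil>) run)) \<le> ennreal (c * cost / a)"
      unfolding run repeat_spmf_of_pmf measure_spmf_spmf_of_pmf tot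
      using amp(2) ennreal_leI[OF T(4)] by (rule order_trans)
    show "measure (measure_spmf (repeat_spmf (nat \<lceil>6 / a\<rceil>) run))
                  {rs. real (total_queries rs) \<le> c * cost / a \<and>
                       (\<exists>r \<in> set rs. success n B w \<tau> r \<and> accurate n B w \<tau> r)} \<ge> 2 / 3"
      using amp(3) unfolding run repeat_spmf_of_pmf measure_spmf_spmf_of_pmf tot by simp
  qed
qed

theorem proposition1:
  "\<exists>c::real. c > 0 \<and> (\<forall>\<tau> :: nat \<Rightarrow> real.
     (\<forall>n. \<tau> n > 0) \<longrightarrow> \<tau> \<in> \<omega>(\<lambda>n. ln (2 ^ n) / 2 ^ n) \<longrightarrow>
     (\<forall>(n :: nat) B w. bij_betw B {..<2 ^ n} {..<2 ^ n} \<longrightarrow> w < 2 ^ n \<longrightarrow> w \<noteq> 0 \<longrightarrow>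
        draw_prob {} n B w (\<tau> n) = adv n B w (2 ^ n * \<tau> n) \<and>
        (\<tau> n \<le> 1 \<longrightarrow> draw_prob zero_pairs n B w (\<tau> n)
           = (adv n B w (2 ^ n * \<tau> n) - 1 / 2 ^ n) / (1 - 1 / 2 ^ n)) \<and>
        (\<forall>rej \<in> {{}, zero_pairs}.
         \<forall>(verify, cost) \<in> {(quantum_estimate, 1 / sqrt (\<tau> n)), (classical_estimate, 1 / \<tau> n)}.
           let a = draw_prob rej n B w (\<tau> n);
               run = fishing rej verify n B w (\<tau> n)
           in
             lossless_spmf run \<and>
             measure (measure_spmf run) {r. success n B w (\<tau> n) r} = a \<and>
             (\<integral>\<^sup>+ r. ennreal (real (queries1 r)) \<partial>measure_spmf run) \<le> ennreal c \<and>
             (\<tau> n \<le> 1 \<longrightarrow> (\<forall>r \<in> set_spmf run. real (queries2 r) \<le> c * cost)) \<and>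
             (\<forall>\<alpha><2 ^ n. \<forall>\<beta><2 ^ n.
                measure_pmf.prob (verify n B w (\<alpha>, \<beta>) (sqrt (\<tau> n)))
                  {(e, q). \<bar>e - Cor n B w (\<alpha>, \<beta>)\<bar> \<le> sqrt (\<tau> n)} \<ge> 2 / 3) \<and>
             (a > 0 \<longrightarrow> (\<exists>k. real k \<le> c / a \<and>
                (\<integral>\<^sup>+ rs. ennreal (real (total_queries rs)) \<partial>measure_spmf (repeat_spmf k run))
                  \<le> ennreal (c * cost / a) \<and>
                measure (measure_spmf (repeat_spmf k run))
                  {rs. real (total_queries rs) \<le> c * cost / a \<and>
                       (\<exists>r \<in> set rs. success n B w (\<tau> n) r \<and> accurate n B w (\<tau> n) r)}
                  \<ge> 2 / 3)))))"
proof (intro exI[of _ 20000] conjI allI impI)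
  fix \<tau> :: "nat \<Rightarrow> real" and n :: nat and B :: "nat \<Rightarrow> nat" and w :: nat
  assume pos: "\<forall>n. 0 < \<tau> n" and B: "bij_betw B {..<2 ^ n} {..<2 ^ n}" and w: "w < 2 ^ n" "w \<noteq> 0"
  show "draw_prob {} n B w (\<tau> n) = adv n B w (2 ^ n * \<tau> n)" by (rule draw_prob_empty[OF B w(1)])
  show "draw_prob zero_pairs n B w (\<tau> n) = (adv n B w (2 ^ n * \<tau> n) - 1 / 2 ^ n) / (1 - 1 / 2 ^ n)"
    if "\<tau> n \<le> 1" by (rule draw_prob_zero_pairs[OF B w that])
  have \<tau>: "\<tau> n > 0" "sqrt (\<tau> n) > 0" using pos by auto
  have acc: "measure (verify n B w (\<alpha>, \<beta>) (sqrt (\<tau> n))) {(e, q). \<bar>e - Cor n B w (\<alpha>, \<beta>)\<bar> \<le> sqrt (\<tau> n)} \<ge> 2 / 3"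
    if "(verify, cost) \<in> {(quantum_estimate, 1 / sqrt (\<tau> n)), (classical_estimate, 1 / \<tau> n)}"
    for verify :: verifier and cost :: real and \<alpha> \<beta>
    using that quantum_estimate_accurate[OF B w(1) \<tau>(2)] classical_estimate_accurate[OF \<tau>(2)] by auto
  have cost: "real q \<le> 264 * cost"
    if "(verify, cost) \<in> {(quantum_estimate, 1 / sqrt (\<tau> n)), (classical_estimate, 1 / \<tau> n)}"
      "\<tau> n \<le> 1" "(e, q) \<in> set_pmf (verify n B w p (sqrt (\<tau> n)))"
    for verify :: verifier and cost p e q
  proof -
    have s: "sqrt (\<tau> n) \<le> 1" "(sqrt (\<tau> n))\<^sup>2 = \<tau> n" using that(2) \<tau> by auto
    \<comment> \<open>The classical constant 8 is enlarged to the quantum one, so that both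
      verifiers meet the same bound.\<close>
    have "8 / \<tau> n \<le> 264 / \<tau> n" using \<tau> by (intro divide_right_mono) auto
    then show "real q \<le> 264 * cost"
      using that(1,3) quantum_estimate_queries[OF B w(1) \<tau>(2) s(1), of e q p]
        classical_estimate_queries[OF \<tau>(2) s(1), of e q n B w p] s(2)
      by (cases p) auto
  qed
  have cost1: "1 \<le> cost"
    if "(verify, cost) \<in> {(quantum_estimate, 1 / sqrt (\<tau> n)), (classical_estimate, 1 / \<tau> n)}" "\<tau> n \<le> 1"
    for verify :: verifier and cost
    using that \<tau> by auto
  show "\<forall>rej \<in> {{}, zero_pairs}.
         \<forall>(verify, cost) \<in> {(quantum_estimate, 1 / sqrt (\<tau> n)), (classical_estimate, 1 / \<tau> n)}.
           let a = draw_prob rej n B w (\<tau> n);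
               run = fishing rej verify n B w (\<tau> n)
           in
             lossless_spmf run \<and>
             measure (measure_spmf run) {r. success n B w (\<tau> n) r} = a \<and>
             (\<integral>\<^sup>+ r. ennreal (real (queries1 r)) \<partial>measure_spmf run) \<le> ennreal 20000 \<and>
             (\<tau> n \<le> 1 \<longrightarrow> (\<forall>r \<in> set_spmf run. real (queries2 r) \<le> 20000 * cost)) \<and>
             (\<forall>\<alpha><2 ^ n. \<forall>\<beta><2 ^ n.
                measure_pmf.prob (verify n B w (\<alpha>, \<beta>) (sqrt (\<tau> n)))
                  {(e, q). \<bar>e - Cor n B w (\<alpha>, \<beta>)\<bar> \<le> sqrt (\<tau> n)} \<ge> 2 / 3) \<and>
             (a > 0 \<longrightarrow> (\<exists>k. real k \<le> 20000 / a \<and>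
                (\<integral>\<^sup>+ rs. ennreal (real (total_queries rs)) \<partial>measure_spmf (repeat_spmf k run))
                  \<le> ennreal (20000 * cost / a) \<and>
                measure (measure_spmf (repeat_spmf k run))
                  {rs. real (total_queries rs) \<le> 20000 * cost / a \<and>
                       (\<exists>r \<in> set rs. success n B w (\<tau> n) r \<and> accurate n B w (\<tau> n) r)}
                  \<ge> 2 / 3))"
    unfolding Let_def
  proof (intro ballI, clarify, intro conjI impI)
    fix rej and verify :: verifier and cost :: real
    assume rej: "rej \<in> {{}, zero_pairs}"
      and v: "(verify, cost) \<in> {(quantum_estimate, 1 / sqrt (\<tau> n)), (classical_estimate, 1 / \<tau> n)}"
    note F = fishing_run[where verify = verify and cost = cost, OF B w rej \<tau>(1) acc[OF v] cost[OF v] cost1[OF v]]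
    show "lossless_spmf (fishing rej verify n B w (\<tau> n))" by (rule F(1))
    show "measure (measure_spmf (fishing rej verify n B w (\<tau> n))) {r. success n B w (\<tau> n) r} = draw_prob rej n B w (\<tau> n)"
      by (rule F(2))
    show "(\<integral>\<^sup>+ r. ennreal (real (queries1 r)) \<partial>measure_spmf (fishing rej verify n B w (\<tau> n))) \<le> ennreal 20000"
      by (rule F(3))
    show "\<forall>r\<in>set_spmf (fishing rej verify n B w (\<tau> n)). real (queries2 r) \<le> 20000 * cost" if "\<tau> n \<le> 1"
      by (rule F(4)[OF _ _ _ that])
    show "\<forall>\<alpha><2 ^ n. \<forall>\<beta><2 ^ n. measure_pmf.prob (verify n B w (\<alpha>, \<beta>) (sqrt (\<tau> n)))
        {(e, q). \<bar>e - Cor n B w (\<alpha>, \<beta>)\<bar> \<le> sqrt (\<tau> n)} \<ge> 2 / 3"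
      using acc[OF v] by blast
    show "\<exists>k. real k \<le> 20000 / draw_prob rej n B w (\<tau> n) \<and>
        (\<integral>\<^sup>+ rs. ennreal (real (total_queries rs)) \<partial>measure_spmf (repeat_spmf k (fishing rej verify n B w (\<tau> n))))
          \<le> ennreal (20000 * cost / draw_prob rej n B w (\<tau> n)) \<and>
        measure (measure_spmf (repeat_spmf k (fishing rej verify n B w (\<tau> n))))
          {rs. real (total_queries rs) \<le> 20000 * cost / draw_prob rej n B w (\<tau> n) \<and>
               (\<exists>r \<in> set rs. success n B w (\<tau> n) r \<and> accurate n B w (\<tau> n) r)} \<ge> 2 / 3"
      if "draw_prob rej n B w (\<tau> n) > 0"
      by (rule F(5)[OF _ _ _ that])
  qed
qed simp

end
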